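(* Every finitely presented group $G$ with Kazhdan's Property (T) admits a finite just-(T) presentation. That is, for every such $G$ there exist a finite set $X$ and a finite set $R$ of relations over $X$ such that $\langle X \mid R \rangle$ is a presentation of $G$ and, for every $r \in R$, the group $\langle X \mid R \setminus \{r\} \rangle$ does not have Property (T).
   Context: Groups are regarded as discrete groups, and Property (T) is Kazhdan's Property (T). A presentation $\langle X \mid R \rangle$ of a group with Property (T) is called just-(T) if, for every $r \in R$, the group $\langle X \mid R \setminus \{r\} \rangle$ does not have Property (T). A presentation is finite if both $X$ and $R$ are finite. *)

theory Defs
  imports
    "HOL-Analysis.Analysis"
    "HOL-Algebra.Group_Action"
    "HOL-Algebra.Module"
begin

section \<open>Unitary representations\<close>

definition complex_ring :: "complex ring" where
  "complex_ring = \<lparr>carrier = UNIV, mult = (*), one = 1, zero = 0, add = (+)\<rparr>"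

text \<open>
  The fields \<open>mult\<close> and \<open>one\<close> that \<open>hilbert\<close> inherits from the record of modules play no
  role.  The inner product is linear in its first argument.
\<close>

record 'v hilbert = "(complex, 'v) module" +
  cinner :: "'v \<Rightarrow> 'v \<Rightarrow> complex"

definition hnorm :: "('v, 'm) hilbert_scheme \<Rightarrow> 'v \<Rightarrow> real" where
  "hnorm H x = sqrt (Re (cinner H x x))"

locale hilbert_space =
  module complex_ring H
  for H :: "('v, 'm) hilbert_scheme" (structure) +
  assumes cinner_add_left:
      "\<lbrakk>x \<in> carrier H; y \<in> carrier H; z \<in> carrier H\<rbrakk>
        \<Longrightarrow> cinner H (x \<oplus> y) z = cinner H x z + cinner H y z"
    and cinner_smult_left:
      "\<lbrakk>x \<in> carrier H; y \<in> carrier H\<rbrakk> \<Longrightarrow> cinner H (c \<odot> x) y = c * cinner H x y"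
    and cinner_commute:
      "\<lbrakk>x \<in> carrier H; y \<in> carrier H\<rbrakk> \<Longrightarrow> cinner H x y = cnj (cinner H y x)"
    and cinner_nonneg:
      "x \<in> carrier H \<Longrightarrow> 0 \<le> Re (cinner H x x)"
    and cinner_eq_zero:
      "\<lbrakk>x \<in> carrier H; cinner H x x = 0\<rbrakk> \<Longrightarrow> x = \<zero>"
    and complete:
      "\<lbrakk>range u \<subseteq> carrier H;
        \<forall>e>0. \<exists>N. \<forall>m\<ge>N. \<forall>n\<ge>N. hnorm H (u m \<ominus> u n) < e\<rbrakk>
        \<Longrightarrow> \<exists>x\<in>carrier H. (\<lambda>n. hnorm H (u n \<ominus> x)) \<longlonglongrightarrow> 0"

text \<open>
  Strong continuity is automatic, because all groups are discrete.
\<close>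

locale unitary_representation =
  group_action G "carrier H" \<pi> + hilbert_space H
  for G (structure) and H :: "('v, 'm) hilbert_scheme" (structure) and \<pi> +
  assumes rep_add:
      "\<lbrakk>g \<in> carrier G; x \<in> carrier H; y \<in> carrier H\<rbrakk>
        \<Longrightarrow> \<pi> g (x \<oplus>\<^bsub>H\<^esub> y) = \<pi> g x \<oplus>\<^bsub>H\<^esub> \<pi> g y"
    and rep_smult:
      "\<lbrakk>g \<in> carrier G; x \<in> carrier H\<rbrakk> \<Longrightarrow> \<pi> g (c \<odot>\<^bsub>H\<^esub> x) = c \<odot>\<^bsub>H\<^esub> \<pi> g x"
    and rep_cinner:
      "\<lbrakk>g \<in> carrier G; x \<in> carrier H; y \<in> carrier H\<rbrakk>
        \<Longrightarrow> cinner H (\<pi> g x) (\<pi> g y) = cinner H x y"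


section \<open>Property (T) for discrete groups\<close>

definition almost_invariant_vector ::
  "('v, 'm) hilbert_scheme \<Rightarrow> ('a \<Rightarrow> 'v \<Rightarrow> 'v) \<Rightarrow> 'a set \<Rightarrow> real \<Rightarrow> 'v \<Rightarrow> bool" where
  "almost_invariant_vector H \<pi> Q \<epsilon> x \<longleftrightarrow>
     x \<in> carrier H \<and> x \<noteq> \<zero>\<^bsub>H\<^esub> \<and> (\<forall>g\<in>Q. hnorm H (\<pi> g x \<ominus>\<^bsub>H\<^esub> x) < \<epsilon> * hnorm H x)"

definition nonzero_invariant_vector ::
  "('a, 'b) monoid_scheme \<Rightarrow> ('v, 'm) hilbert_scheme \<Rightarrow> ('a \<Rightarrow> 'v \<Rightarrow> 'v) \<Rightarrow> 'v \<Rightarrow> bool" where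
  "nonzero_invariant_vector G H \<pi> x \<longleftrightarrow>
     x \<in> carrier H \<and> x \<noteq> \<zero>\<^bsub>H\<^esub> \<and> (\<forall>g\<in>carrier G. \<pi> g x = x)"

definition kazhdan_pair ::
  "'v itself \<Rightarrow> ('a, 'b) monoid_scheme \<Rightarrow> 'a set \<Rightarrow> real \<Rightarrow> bool" where
  "kazhdan_pair _ G Q \<epsilon> \<longleftrightarrow>
     (\<forall>(H :: 'v hilbert) \<pi>. unitary_representation G H \<pi> \<longrightarrow>
        (\<exists>x. almost_invariant_vector H \<pi> Q \<epsilon> x) \<longrightarrow>
        (\<exists>x. nonzero_invariant_vector G H \<pi> x))"

text \<open>
  A compact subset of a discrete group is a finite one.

  A definition cannot quantify over all types \<open>'v\<close> in which a Hilbert space may be carried, and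
  \<open>'a list \<Rightarrow> complex\<close> is large enough for a group whose elements have type \<open>'a\<close>:  the closed
  linear span of the orbit of an almost invariant vector is a subrepresentation that has an
  orthonormal basis of cardinality at most that of \<open>'a list\<close>, hence it is isomorphic to a
  representation on a space of square-summable functions \<open>'a list \<Rightarrow> complex\<close>.  So the pairs
  \<open>(Q, \<epsilon>)\<close> below are exactly those that satisfy the condition for Hilbert spaces of any size.
\<close>

definition property_T :: "('a, 'b) monoid_scheme \<Rightarrow> bool" where
  "property_T G \<longleftrightarrow>
     (\<exists>Q \<epsilon>. finite Q \<and> Q \<subseteq> carrier G \<and> \<epsilon> > 0 \<and>
        kazhdan_pair TYPE('a list \<Rightarrow> complex) G Q \<epsilon>)"


section \<open>Free groups and group presentations\<close>

text \<open>
  The letter \<open>(x, True)\<close> stands for the generator \<open>x\<close> and \<open>(x, False)\<close> for its inverse.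
  The elements of the free group are the reduced words.
\<close>

type_synonym 'x word = "('x \<times> bool) list"

definition inv_letter :: "'x \<times> bool \<Rightarrow> 'x \<times> bool" where
  "inv_letter a = (fst a, \<not> snd a)"

definition reduced_word :: "'x word \<Rightarrow> bool" where
  "reduced_word w \<longleftrightarrow> successively (\<lambda>a b. b \<noteq> inv_letter a) w"

fun reduced_Cons :: "'x \<times> bool \<Rightarrow> 'x word \<Rightarrow> 'x word" where
  "reduced_Cons a [] = [a]"
| "reduced_Cons a (b # w) = (if b = inv_letter a then w else a # b # w)"

definition free_group :: "'x set \<Rightarrow> 'x word monoid" where
  "free_group X =
     \<lparr>carrier = {w. fst ` set w \<subseteq> X \<and> reduced_word w},
      mult = (\<lambda>u v. foldr reduced_Cons u v),
      one = []\<rparr>"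

definition normal_closure :: "('a, 'b) monoid_scheme \<Rightarrow> 'a set \<Rightarrow> 'a set" where
  "normal_closure G R = (\<lambda>N. N \<lhd> G) hull R"

definition presented_group :: "'x set \<Rightarrow> 'x word set \<Rightarrow> 'x word set monoid" where
  "presented_group X R = free_group X Mod normal_closure (free_group X) R"

definition is_presentation :: "('a, 'b) monoid_scheme \<Rightarrow> 'x set \<Rightarrow> 'x word set \<Rightarrow> bool" where
  "is_presentation G X R \<longleftrightarrow> R \<subseteq> carrier (free_group X) \<and> presented_group X R \<cong> G"

text \<open>
  Every finite set of generators is in bijection with a finite set of natural numbers.
\<close>

definition finitely_presented :: "('a, 'b) monoid_scheme \<Rightarrow> bool" where
  "finitely_presented G \<longleftrightarrow>
     (\<exists>(X :: nat set) R. finite X \<and> finite R \<and> is_presentation G X R)"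

definition just_T :: "'x set \<Rightarrow> 'x word set \<Rightarrow> bool" where
  "just_T X R \<longleftrightarrow>
     property_T (presented_group X R) \<and>
     (\<forall>r\<in>R. \<not> property_T (presented_group X (R - {r})))"


subsection \<open>Presented groups are groups\<close>

lemma inv_letter_inv_letter [simp]: "inv_letter (inv_letter a) = a"
  by (simp add: inv_letter_def)

lemma reduced_Nil [simp]: "reduced_word []"
  by (simp add: reduced_word_def)

lemma reduced_reduced_Cons: "reduced_word w \<Longrightarrow> reduced_word (reduced_Cons a w)"
  by (cases w) (auto simp: reduced_word_def successively_Cons)

lemma reduced_Cons_inv_letter:
  "reduced_word w \<Longrightarrow> reduced_Cons a (reduced_Cons (inv_letter a) w) = w"
  by (cases w; cases "tl w") (auto simp: reduced_word_def successively_Cons)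

lemma reduced_foldr: "reduced_word v \<Longrightarrow> reduced_word (foldr reduced_Cons u v)"
  by (induction u) (auto intro: reduced_reduced_Cons)

lemma foldr_reduced_Cons_assoc:
  assumes "reduced_word w"
  shows "foldr reduced_Cons (foldr reduced_Cons u v) w
      = foldr reduced_Cons u (foldr reduced_Cons v w)"
proof -
  have "foldr reduced_Cons (reduced_Cons a z) w = reduced_Cons a (foldr reduced_Cons z w)"
    for a z
    using reduced_Cons_inv_letter[OF reduced_foldr[OF assms]] by (cases z) auto
  then show ?thesis
    by (induction u) auto
qed

lemma set_reduced_Cons: "set (reduced_Cons a w) \<subseteq> insert a (set w)"
  by (cases w) auto

lemma set_foldr_reduced_Cons: "set (foldr reduced_Cons u v) \<subseteq> set u \<union> set v"
proof (induction u)
  case (Cons a u)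
  then show ?case
    using set_reduced_Cons[of a "foldr reduced_Cons u v"] by auto
qed simp

lemma foldr_reduced_Cons_rev:
  "foldr reduced_Cons (rev (map inv_letter w)) w = []"
proof (induction w)
  case (Cons a w)
  have "reduced_Cons (inv_letter a) (a # w) = w"
    by simp
  with Cons show ?case
    by simp
qed simp

lemma reduced_rev_map:
  assumes "reduced_word w"
  shows "reduced_word (rev (map inv_letter w))"
proof -
  have "successively (\<lambda>a b. inv_letter a \<noteq> inv_letter (inv_letter b)) w"
    using assms unfolding reduced_word_def
    by (rule successively_mono) (use inv_letter_inv_letter in metis)
  then show ?thesis
    by (simp only: reduced_word_def successively_rev successively_map)
qed

lemma group_free_group: "group (free_group X)"
proof (rule groupI)
  fix x y
  assume "x \<in> carrier (free_group X)" "y \<in> carrier (free_group X)"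
  then show "x \<otimes>\<^bsub>free_group X\<^esub> y \<in> carrier (free_group X)"
    using set_foldr_reduced_Cons[of x y] by (fastforce simp: free_group_def reduced_foldr)
next
  fix x
  assume x: "x \<in> carrier (free_group X)"
  have "rev (map inv_letter x) \<in> carrier (free_group X)"
    using x by (auto simp: free_group_def reduced_rev_map inv_letter_def)
  moreover have "rev (map inv_letter x) \<otimes>\<^bsub>free_group X\<^esub> x = \<one>\<^bsub>free_group X\<^esub>"
    by (simp add: free_group_def foldr_reduced_Cons_rev)
  ultimately show "\<exists>y\<in>carrier (free_group X). y \<otimes>\<^bsub>free_group X\<^esub> x = \<one>\<^bsub>free_group X\<^esub>"
    by blast
qed (auto simp: free_group_def foldr_reduced_Cons_assoc)

lemma normal_normal_closure:
  assumes "group G" and "R \<subseteq> carrier G"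
  shows "normal_closure G R \<lhd> G"
proof -
  interpret group G by fact
  have "carrier G \<lhd> G"
    by (simp add: normal_inv_iff subgroup_self)
  moreover have "\<Inter>\<N> \<lhd> G" if "\<And>N. N \<in> \<N> \<Longrightarrow> N \<lhd> G" "\<N> \<noteq> {}" for \<N>
    using that subgroups_Inter[of \<N>] unfolding normal_inv_iff by blast
  ultimately show ?thesis
    unfolding normal_closure_def hull_def using assms(2)
    by (metis (no_types, lifting) empty_iff mem_Collect_eq)
qed

lemma group_presented_group:
  "R \<subseteq> carrier (free_group X) \<Longrightarrow> group (presented_group X R)"
  unfolding presented_group_def
  by (intro normal.factorgroup_is_group normal_normal_closure group_free_group)

end

theory Submission
  imports Defs
begin

text \<open>
  Start from a finite presentation \<open>\<langle>X | R\<rangle>\<close> of the group that is irredundant:  no \<open>r \<in> R\<close> lies in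
  the normal closure of \<open>R - {r}\<close>.  Deleting a relator then changes the group, but the larger group
  may still have Property (T).  The remedy is to attach to each relator \<open>r\<close> two new generators
  \<open>a\<close>, and to each of them the one relator that says \<open>a\<^sup>9 = (a r a r\<inverse>)\<^sup>5\<close>.  If \<open>r = 1\<close>, it reads
  \<open>a\<^sup>9 = a\<^sup>1\<^sup>0\<close> and kills \<open>a\<close>, so the group has not changed (\<open>presented_group_iso\<close>).  Each deletion
  now destroys Property (T).

  If the relator of a new generator \<open>a\<close> is deleted, the group maps onto the integers by \<open>a \<mapsto> 1\<close>.
  Its one-dimensional representations \<open>a \<mapsto> z\<close> with \<open>|z| = 1\<close> and \<open>z\<close> close to \<open>1\<close> have almost
  invariant vectors and no invariant ones (\<open>not_property_T_without_killer\<close>).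

  If \<open>r \<in> R\<close> is deleted, then \<open>r \<noteq> 1\<close> in \<open>\<Gamma> = \<langle>X | R - {r}\<rangle>\<close>.  The new generators of the other
  relators can be sent to \<open>1\<close>, so it is enough to find, for the group generated by \<open>\<Gamma>\<close> and two
  elements \<open>a\<close>, \<open>b\<close> with the two relators above, unitary representations with almost
  invariant vectors and no invariant ones (\<open>unitary_deformation\<close>).  Let \<open>\<Gamma>\<close> act on a set that
  consists of fixed points and of infinitely many copies of \<open>\<Gamma>\<close>.  Two 3-cycles \<open>(y c d)\<close> and
  \<open>(y rc rd)\<close> that share one point have the product of order 5, since it is a 5-cycle.  Hence a
  permutation that is a product of disjoint 3-cycles \<open>(y c d)\<close>, with \<open>y\<close> fixed by \<open>r\<close> and \<open>c\<close>,
  \<open>d\<close> in different copies of \<open>\<Gamma>\<close>, satisfies the relator;  here \<open>r \<noteq> 1\<close> is used.  Choose two such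
  permutations \<open>a\<close> and \<open>b\<close> that together with \<open>\<Gamma>\<close> link all points, except one point \<open>\<infinity>\<close> that
  everything fixes, into a single infinite orbit.  In the space of square-summable functions the
  invariant vectors are then the multiples of \<open>\<delta>\<^sub>\<infinity>\<close>.  Finally conjugate the operator of \<open>a\<close>, and only
  this one, by a rotation through a small angle in the plane spanned by \<open>\<delta>\<^sub>\<infinity>\<close> and \<open>\<delta>\<^sub>y\<close>, where \<open>y\<close> is
  a point that \<open>\<Gamma>\<close> fixes.  The rotation commutes with \<open>\<Gamma>\<close>, so the relators persist;  \<open>\<delta>\<^sub>\<infinity>\<close>
  is almost fixed, but nothing except \<open>0\<close> is fixed any more.

  Property (T) is defined through Hilbert spaces carried by one particular type of functions.
  Both the invariance of the property under isomorphism and the use of representations on other types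
  require that a Kazhdan pair works for all Hilbert spaces (\<open>kazhdan_pair_transfer\<close>).
\<close>

section \<open>Hilbert spaces and their unitary groups\<close>

context hilbert_space
begin

lemma smult_in_carrier [simp, intro]: "x \<in> carrier H \<Longrightarrow> c \<odot> x \<in> carrier H"
  by (simp add: complex_ring_def)

lemma cinner_add_right:
  assumes "x \<in> carrier H" "y \<in> carrier H" "z \<in> carrier H"
  shows "cinner H x (y \<oplus> z) = cinner H x y + cinner H x z"
  using assms by (metis M.a_closed cinner_add_left cinner_commute complex_cnj_add)

lemma cinner_smult_right:
  assumes "x \<in> carrier H" "y \<in> carrier H"
  shows "cinner H x (c \<odot> y) = cnj c * cinner H x y"
  using assms by (metis smult_in_carrier cinner_smult_left cinner_commute complex_cnj_mult)

lemma cinner_zero_left [simp]: "x \<in> carrier H \<Longrightarrow> cinner H \<zero> x = 0"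
  using cinner_add_left[of \<zero> \<zero> x] by simp

lemma cinner_zero_right [simp]: "x \<in> carrier H \<Longrightarrow> cinner H x \<zero> = 0"
  using cinner_add_right[of x \<zero> \<zero>] by simp

lemma cinner_minus_left:
  assumes "x \<in> carrier H" "y \<in> carrier H"
  shows "cinner H (\<ominus> x) y = - cinner H x y"
proof -
  have "cinner H (\<ominus> x) y + cinner H x y = 0"
    using assms cinner_add_left[of "\<ominus> x" x y] by (simp add: M.l_neg)
  then show ?thesis
    by (simp add: eq_neg_iff_add_eq_0)
qed

lemma cinner_diff_left:
  assumes "x \<in> carrier H" "y \<in> carrier H" "z \<in> carrier H"
  shows "cinner H (x \<ominus> y) z = cinner H x z - cinner H y z"
  using assms by (simp add: a_minus_def cinner_add_left cinner_minus_left)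

lemma cinner_diff_right:
  assumes "x \<in> carrier H" "y \<in> carrier H" "z \<in> carrier H"
  shows "cinner H z (x \<ominus> y) = cinner H z x - cinner H z y"
  using assms by (metis M.minus_closed cinner_commute cinner_diff_left complex_cnj_diff)

lemma hnorm_nonneg [simp]: "x \<in> carrier H \<Longrightarrow> 0 \<le> hnorm H x"
  by (simp add: hnorm_def cinner_nonneg)

lemma cinner_self: "x \<in> carrier H \<Longrightarrow> cinner H x x = complex_of_real ((hnorm H x)\<^sup>2)"
proof -
  assume x: "x \<in> carrier H"
  have "Im (cinner H x x) = 0"
    using arg_cong[OF cinner_commute[OF x x], of Im] by simp
  then show ?thesis
    using cinner_nonneg[OF x] by (simp add: hnorm_def complex_eq_iff)
qed

lemma hnorm_zero [simp]: "hnorm H \<zero> = 0"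
  by (simp add: hnorm_def)

lemma hnorm_eq_zero: "x \<in> carrier H \<Longrightarrow> hnorm H x = 0 \<longleftrightarrow> x = \<zero>"
  using cinner_self cinner_eq_zero by fastforce

lemma hnorm_smult: "x \<in> carrier H \<Longrightarrow> hnorm H (c \<odot> x) = cmod c * hnorm H x"
proof -
  assume x: "x \<in> carrier H"
  have "cinner H (c \<odot> x) (c \<odot> x) = (c * cnj c) * cinner H x x"
    using x by (simp add: cinner_smult_left cinner_smult_right)
  also have "\<dots> = complex_of_real ((cmod c * hnorm H x)\<^sup>2)"
    using x by (simp add: cinner_self complex_norm_square[symmetric] power_mult_distrib)
  finally have "hnorm H (c \<odot> x) = sqrt ((cmod c * hnorm H x)\<^sup>2)"
    by (simp only: hnorm_def[of H "c \<odot> x"] Re_complex_of_real)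
  then show ?thesis
    using x by simp
qed

text \<open>
  Subtracting from \<open>x\<close> its projection to the line of \<open>y\<close> leaves a vector \<open>z\<close> orthogonal to
  \<open>y\<close>, and \<open>0 \<le> \<langle>z, z\<rangle> = |x|\<^sup>2 - |\<langle>x, y\<rangle>|\<^sup>2 / |y|\<^sup>2\<close>.
\<close>

lemma Cauchy_Schwarz:
  assumes x: "x \<in> carrier H" and y: "y \<in> carrier H"
  shows "cmod (cinner H x y) \<le> hnorm H x * hnorm H y"
proof (cases "y = \<zero>")
  case False
  define a where "a = cinner H x y"
  define n where "n = hnorm H y"
  have n: "n > 0"
    using False y hnorm_eq_zero[OF y] hnorm_nonneg[OF y] unfolding n_def by linarith
  define c where "c = a / complex_of_real (n\<^sup>2)"
  define z where "z = x \<ominus> c \<odot> y"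
  have [simp]: "c \<odot> y \<in> carrier H" "z \<in> carrier H"
    using x y by (auto simp: z_def)
  have yx: "cinner H y x = cnj a"
    using cinner_commute[OF y x] by (simp add: a_def)
  have "cinner H z y = 0"
    using x y n by (simp add: z_def cinner_diff_left cinner_smult_left cinner_self c_def
        flip: a_def n_def)
  then have "cinner H z z = cinner H z x"
    using x y by (subst (2) z_def) (simp add: cinner_diff_right cinner_smult_right)
  also have "\<dots> = complex_of_real ((hnorm H x)\<^sup>2) - a * cnj a / complex_of_real (n\<^sup>2)"
    using x y by (simp add: z_def cinner_diff_left cinner_smult_left cinner_self yx c_def)
  also have "\<dots> = complex_of_real ((hnorm H x)\<^sup>2 - (cmod a)\<^sup>2 / n\<^sup>2)"
    by (simp flip: complex_norm_square)
  finally have "0 \<le> (hnorm H x)\<^sup>2 - (cmod a)\<^sup>2 / n\<^sup>2"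
    using cinner_nonneg[of z] by simp
  then have "(cmod a)\<^sup>2 \<le> (hnorm H x * n)\<^sup>2"
    using n by (simp add: divide_simps power_mult_distrib split: if_splits)
  then show ?thesis
    using x n by (simp add: a_def n_def abs_le_square_iff[symmetric])
qed (use x in simp)

lemma hnorm_triangle:
  assumes x: "x \<in> carrier H" and y: "y \<in> carrier H"
  shows "hnorm H (x \<oplus> y) \<le> hnorm H x + hnorm H y"
proof -
  have "cinner H (x \<oplus> y) (x \<oplus> y) =
      cinner H x x + cinner H y y + (cinner H x y + cnj (cinner H x y))"
    using x y cinner_commute[OF y x] by (simp add: cinner_add_left cinner_add_right)
  then have "(hnorm H (x \<oplus> y))\<^sup>2 = (hnorm H x)\<^sup>2 + (hnorm H y)\<^sup>2 + 2 * Re (cinner H x y)"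
    using x y by (simp add: cinner_self complex_eq_iff)
  also have "\<dots> \<le> (hnorm H x)\<^sup>2 + (hnorm H y)\<^sup>2 + 2 * (hnorm H x * hnorm H y)"
    using Cauchy_Schwarz[OF x y] complex_Re_le_cmod[of "cinner H x y"] by linarith
  also have "\<dots> = (hnorm H x + hnorm H y)\<^sup>2"
    by (simp add: power2_sum)
  finally show ?thesis
    using x y by (simp add: abs_le_square_iff[symmetric])
qed

lemma hnorm_diff_triangle:
  assumes x: "x \<in> carrier H" and y: "y \<in> carrier H" and z: "z \<in> carrier H"
  shows "hnorm H (x \<ominus> z) \<le> hnorm H (x \<ominus> y) + hnorm H (y \<ominus> z)"
proof -
  have "x \<ominus> z = x \<oplus> ((\<ominus> y \<oplus> y) \<oplus> \<ominus> z)"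
    using x y z by (simp add: a_minus_def M.l_neg)
  also have "\<dots> = (x \<ominus> y) \<oplus> (y \<ominus> z)"
    using x y z by (simp add: a_minus_def M.a_assoc)
  finally show ?thesis
    using hnorm_triangle[of "x \<ominus> y" "y \<ominus> z"] x y z by simp
qed

lemma diff_eq_zero:
  assumes "x \<in> carrier H" "y \<in> carrier H" "x \<ominus> y = \<zero>"
  shows "x = y"
proof -
  have "x = x \<oplus> (\<ominus> y \<oplus> y)"
    using assms by (simp add: M.l_neg)
  also have "\<dots> = (x \<ominus> y) \<oplus> y"
    using assms(1,2) by (simp add: a_minus_def M.a_assoc)
  finally show ?thesis
    using assms by simp
qed

lemma diff_smult_self:
  assumes x: "x \<in> carrier H"
  shows "(c \<odot> x) \<ominus> x = (c - 1) \<odot> x"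
proof -
  have "c \<odot> x = ((c - 1) + 1) \<odot> x"
    by simp
  also have "\<dots> = (c - 1) \<odot> x \<oplus> x"
    using x smult_l_distr[of "c - 1" 1 x] smult_one[of x] by (simp add: complex_ring_def)
  finally show ?thesis
    using x by (simp add: a_minus_def M.a_assoc M.r_neg)
qed

end

text \<open>
  Realising the unitary group inside \<^const>\<open>BijGroup\<close> makes unitary representations the same
  as homomorphisms into it (see \<open>unitary_representation_iff_hom\<close>), so representations can be built
  with the tools for homomorphisms.
\<close>

definition unitary_group :: "('v, 'm) hilbert_scheme \<Rightarrow> ('v \<Rightarrow> 'v) monoid" where
  "unitary_group H = BijGroup (carrier H)\<lparr>carrier := {T \<in> Bij (carrier H).
     (\<forall>x\<in>carrier H. \<forall>y\<in>carrier H. T (x \<oplus>\<^bsub>H\<^esub> y) = T x \<oplus>\<^bsub>H\<^esub> T y \<and>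
        cinner H (T x) (T y) = cinner H x y) \<and>
     (\<forall>c. \<forall>x\<in>carrier H. T (c \<odot>\<^bsub>H\<^esub> x) = c \<odot>\<^bsub>H\<^esub> T x)}\<rparr>"

lemma restrict_in_unitary_group:
  assumes "\<And>x. x \<in> carrier H \<Longrightarrow> T x \<in> carrier H \<and> T' x \<in> carrier H \<and> T (T' x) = x \<and> T' (T x) = x"
    and "\<And>x y. \<lbrakk>x \<in> carrier H; y \<in> carrier H\<rbrakk> \<Longrightarrow> x \<oplus>\<^bsub>H\<^esub> y \<in> carrier H"
    and "\<And>c x. x \<in> carrier H \<Longrightarrow> c \<odot>\<^bsub>H\<^esub> x \<in> carrier H"
    and "\<And>x y. \<lbrakk>x \<in> carrier H; y \<in> carrier H\<rbrakk> \<Longrightarrow> T (x \<oplus>\<^bsub>H\<^esub> y) = T x \<oplus>\<^bsub>H\<^esub> T y"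
    and "\<And>c x. x \<in> carrier H \<Longrightarrow> T (c \<odot>\<^bsub>H\<^esub> x) = c \<odot>\<^bsub>H\<^esub> T x"
    and "\<And>x y. \<lbrakk>x \<in> carrier H; y \<in> carrier H\<rbrakk> \<Longrightarrow> cinner H (T x) (T y) = cinner H x y"
  shows "restrict T (carrier H) \<in> carrier (unitary_group H)"
proof -
  have "bij_betw T (carrier H) (carrier H)"
    using assms(1) by (intro bij_betw_byWitness[where f' = T']) auto
  then have "restrict T (carrier H) \<in> Bij (carrier H)"
    by (auto simp: Bij_def cong: bij_betw_cong)
  then show ?thesis
    using assms by (simp add: unitary_group_def)
qed

lemma one_unitary_group: "\<one>\<^bsub>unitary_group H\<^esub> = (\<lambda>x\<in>carrier H. x)"
  by (simp add: unitary_group_def BijGroup_def)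

lemma mult_unitary_group:
  "\<lbrakk>S \<in> carrier (unitary_group H); T \<in> carrier (unitary_group H)\<rbrakk>
    \<Longrightarrow> S \<otimes>\<^bsub>unitary_group H\<^esub> T = compose (carrier H) S T"
  by (auto simp: unitary_group_def BijGroup_def)

lemma unitary_groupD:
  assumes "T \<in> carrier (unitary_group H)"
  shows unitary_group_Bij: "T \<in> Bij (carrier H)"
    and unitary_group_closed: "x \<in> carrier H \<Longrightarrow> T x \<in> carrier H"
    and unitary_group_add: "\<lbrakk>x \<in> carrier H; y \<in> carrier H\<rbrakk> \<Longrightarrow> T (x \<oplus>\<^bsub>H\<^esub> y) = T x \<oplus>\<^bsub>H\<^esub> T y"
    and unitary_group_smult: "x \<in> carrier H \<Longrightarrow> T (c \<odot>\<^bsub>H\<^esub> x) = c \<odot>\<^bsub>H\<^esub> T x"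
    and unitary_group_cinner:
      "\<lbrakk>x \<in> carrier H; y \<in> carrier H\<rbrakk> \<Longrightarrow> cinner H (T x) (T y) = cinner H x y"
  using assms by (auto simp: unitary_group_def dest: Bij_imp_funcset)

lemma unitary_group_eqI:
  assumes "S \<in> carrier (unitary_group H)" "T \<in> carrier (unitary_group H)"
    and "\<And>x. x \<in> carrier H \<Longrightarrow> S x = T x"
  shows "S = T"
  using assms by (meson extensionalityI unitary_group_Bij Bij_imp_extensional)

lemma (in hilbert_space) group_unitary_group: "group (unitary_group H)"
proof -
  interpret B: group "BijGroup (carrier H)"
    by (rule group_BijGroup)
  let ?U = "carrier (unitary_group H)"
  have "subgroup ?U (BijGroup (carrier H))"
  proof (rule B.subgroupI)
    show "?U \<subseteq> carrier (BijGroup (carrier H))"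
      by (auto simp: unitary_group_def BijGroup_def)
    have "restrict (\<lambda>x. x) (carrier H) \<in> ?U"
      by (rule restrict_in_unitary_group[where T' = "\<lambda>x. x"]) auto
    then show "?U \<noteq> {}"
      by blast
  next
    fix T assume T: "T \<in> ?U"
    define T' where "T' = inv_into (carrier H) T"
    have bij: "bij_betw T (carrier H) (carrier H)"
      using unitary_group_Bij[OF T] by (simp add: Bij_def)
    have T': "T' x \<in> carrier H" "T (T' x) = x" "T' (T x) = x" if "x \<in> carrier H" for x
      using bij that unfolding T'_def
      by (auto simp: bij_betw_inv_into_left bij_betw_inv_into_right bij_betw_def inv_into_into)
    have "restrict T' (carrier H) \<in> ?U"
    proof (rule restrict_in_unitary_group[where T' = T])
      fix x y assume xy: "x \<in> carrier H" "y \<in> carrier H"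
      show "T' (x \<oplus> y) = T' x \<oplus> T' y"
        using xy T' unitary_group_add[OF T, of "T' x" "T' y"] by (metis M.a_closed)
      show "cinner H (T' x) (T' y) = cinner H x y"
        using xy T' unitary_group_cinner[OF T, of "T' x" "T' y"] by simp
    next
      fix c x assume x: "x \<in> carrier H"
      show "T' (c \<odot> x) = c \<odot> T' x"
        using x T' unitary_group_smult[OF T, of "T' x" c] by (metis smult_in_carrier)
    qed (use T' unitary_group_closed[OF T] in auto)
    moreover have "inv\<^bsub>BijGroup (carrier H)\<^esub> T = restrict T' (carrier H)"
      using inv_BijGroup[OF unitary_group_Bij[OF T]] by (simp add: T'_def)
    ultimately show "inv\<^bsub>BijGroup (carrier H)\<^esub> T \<in> ?U"
      by simp
  next
    fix S T assume ST: "S \<in> ?U" "T \<in> ?U"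
    note B = unitary_group_Bij[OF ST(1)] unitary_group_Bij[OF ST(2)]
    have "compose (carrier H) S T \<in> Bij (carrier H)"
      by (intro compose_Bij B)
    moreover have "S \<otimes>\<^bsub>BijGroup (carrier H)\<^esub> T = compose (carrier H) S T"
      using B by (simp add: BijGroup_def)
    ultimately show "S \<otimes>\<^bsub>BijGroup (carrier H)\<^esub> T \<in> ?U"
      using unitary_groupD[OF ST(1)] unitary_groupD[OF ST(2)]
      by (simp add: unitary_group_def compose_eq)
  qed
  then show ?thesis
    using B.subgroup_imp_group[of ?U] by (simp add: unitary_group_def)
qed

lemma (in hilbert_space) inv_unitary_group:
  assumes T: "T \<in> carrier (unitary_group H)" and x: "x \<in> carrier H"
  shows "(inv\<^bsub>unitary_group H\<^esub> T) (T x) = x" "T ((inv\<^bsub>unitary_group H\<^esub> T) x) = x"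
proof -
  interpret U: group "unitary_group H"
    by (rule group_unitary_group)
  have *: "inv\<^bsub>unitary_group H\<^esub> T \<in> carrier (unitary_group H)"
    using T by simp
  have "compose (carrier H) (inv\<^bsub>unitary_group H\<^esub> T) T = (\<lambda>x\<in>carrier H. x)"
    using mult_unitary_group[OF * T] U.l_inv[OF T] by (simp add: one_unitary_group)
  from fun_cong[OF this, of x] show "(inv\<^bsub>unitary_group H\<^esub> T) (T x) = x"
    using x by (simp add: compose_eq)
  have "compose (carrier H) T (inv\<^bsub>unitary_group H\<^esub> T) = (\<lambda>x\<in>carrier H. x)"
    using mult_unitary_group[OF T *] U.r_inv[OF T] by (simp add: one_unitary_group)
  from fun_cong[OF this, of x] show "T ((inv\<^bsub>unitary_group H\<^esub> T) x) = x"
    using x by (simp add: compose_eq)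
qed

lemma hom_BijGroup_unitary_group:
  assumes "\<phi> \<in> hom G (unitary_group H)"
  shows "\<phi> \<in> hom G (BijGroup (carrier H))"
  using assms by (auto simp: hom_def unitary_group_def BijGroup_def Pi_iff)

lemma unitary_representation_iff_hom:
  assumes "group G" "hilbert_space H"
  shows "unitary_representation G H \<pi> \<longleftrightarrow> \<pi> \<in> hom G (unitary_group H)"
proof
  assume \<pi>: "\<pi> \<in> hom G (unitary_group H)"
  have \<pi>c: "\<pi> g \<in> carrier (unitary_group H)" if "g \<in> carrier G" for g
    using \<pi> that by (auto simp: hom_def)
  have "group_action G (carrier H) \<pi>"
    using assms(1) hom_BijGroup_unitary_group[OF \<pi>]
    by (simp add: group_action_def group_hom_def group_hom_axioms_def group_BijGroup)
  then show "unitary_representation G H \<pi>"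
    using assms(2) \<pi>c
    by (intro unitary_representation.intro unitary_representation_axioms.intro)
       (auto simp: unitary_group_add unitary_group_smult unitary_group_cinner)
next
  assume "unitary_representation G H \<pi>"
  then interpret unitary_representation G H \<pi> .
  interpret group_hom G "BijGroup (carrier H)" \<pi>
    by (rule group_hom)
  show "\<pi> \<in> hom G (unitary_group H)"
    using homh bij_prop0 rep_add rep_smult rep_cinner
    by (auto simp: hom_def unitary_group_def BijGroup_def)
qed

section \<open>Independence of Kazhdan pairs from the type that carries the Hilbert space\<close>

lemma cring_complex_ring: "cring complex_ring"
proof (rule cringI)
  show "abelian_group complex_ring"
    by (rule abelian_groupI)
       (auto simp: complex_ring_def intro: exI[of _ "- x" for x :: complex])
  show "Group.comm_monoid complex_ring"
    by (rule comm_monoidI) (auto simp: complex_ring_def)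
qed (auto simp: complex_ring_def algebra_simps)

text \<open>
  Both kinds of Hilbert spaces built below, images of closed subspaces and spaces of square-summable
  functions, consist of complex functions with pointwise operations;  only the inner
  product differs.
\<close>

definition fun_hilbert ::
  "('i \<Rightarrow> complex) set \<Rightarrow> (('i \<Rightarrow> complex) \<Rightarrow> ('i \<Rightarrow> complex) \<Rightarrow> complex) \<Rightarrow> ('i \<Rightarrow> complex) hilbert"
where
  "fun_hilbert E ip = \<lparr>carrier = E, mult = (\<lambda>f g x. f x * g x), one = (\<lambda>x. 1), zero = (\<lambda>x. 0),
     add = (\<lambda>f g x. f x + g x), smult = (\<lambda>c f x. c * f x), cinner = ip\<rparr>"

lemma fun_hilbert_simps [simp]:
  "carrier (fun_hilbert E ip) = E"
  "\<zero>\<^bsub>fun_hilbert E ip\<^esub> = (\<lambda>x. 0)"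
  "f \<oplus>\<^bsub>fun_hilbert E ip\<^esub> g = (\<lambda>x. f x + g x)"
  "c \<odot>\<^bsub>fun_hilbert E ip\<^esub> f = (\<lambda>x. c * f x)"
  "cinner (fun_hilbert E ip) = ip"
  by (simp_all add: fun_hilbert_def)

locale function_space =
  fixes E :: "('i \<Rightarrow> complex) set"
  assumes zero: "(\<lambda>x. 0) \<in> E"
    and add: "\<lbrakk>f \<in> E; g \<in> E\<rbrakk> \<Longrightarrow> (\<lambda>x. f x + g x) \<in> E"
    and smult: "f \<in> E \<Longrightarrow> (\<lambda>x. c * f x) \<in> E"
begin

lemma diff: "\<lbrakk>f \<in> E; g \<in> E\<rbrakk> \<Longrightarrow> (\<lambda>x. f x - g x) \<in> E"
  using add[OF _ smult[of g "-1"], of f] by simp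

lemma abelian_group: "abelian_group (fun_hilbert E ip)"
proof (rule abelian_groupI)
  fix f assume "f \<in> carrier (fun_hilbert E ip)"
  then show "\<exists>g\<in>carrier (fun_hilbert E ip).
      g \<oplus>\<^bsub>fun_hilbert E ip\<^esub> f = \<zero>\<^bsub>fun_hilbert E ip\<^esub>"
    using smult[of f "-1"] by (intro bexI[of _ "\<lambda>x. (-1) * f x"]) auto
qed (auto simp: zero add algebra_simps)

lemma module: "module complex_ring (fun_hilbert E ip)"
  by (rule moduleI[OF cring_complex_ring abelian_group])
     (auto simp: smult complex_ring_def algebra_simps)

lemma minus:
  assumes "f \<in> E" "g \<in> E"
  shows "f \<ominus>\<^bsub>fun_hilbert E ip\<^esub> g = (\<lambda>x. f x - g x)"
proof -
  interpret abelian_group "fun_hilbert E ip"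
    by (rule abelian_group)
  have "\<ominus>\<^bsub>fun_hilbert E ip\<^esub> g = (\<lambda>x. (-1) * g x)"
    using assms smult[of g "-1"] by (intro minus_equality) auto
  then show ?thesis
    by (simp add: a_minus_def)
qed

end

context hilbert_space
begin

definition orthogonal_complement :: "'v set \<Rightarrow> 'v set" where
  "orthogonal_complement A = {x \<in> carrier H. \<forall>y\<in>A. cinner H x y = 0}"

lemma orthogonal_complement_diff:
  assumes "A \<subseteq> carrier H" "x \<in> orthogonal_complement A" "y \<in> orthogonal_complement A"
  shows "x \<ominus> y \<in> orthogonal_complement A"
  using assms by (auto simp: orthogonal_complement_def cinner_diff_left subset_iff)

lemma orthogonal_complement_closed:
  assumes A: "A \<subseteq> carrier H" and u: "range u \<subseteq> orthogonal_complement A"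
    and x: "x \<in> carrier H" and lim: "(\<lambda>n. hnorm H (u n \<ominus> x)) \<longlonglongrightarrow> 0"
  shows "x \<in> orthogonal_complement A"
proof -
  have "cinner H x y = 0" if "y \<in> A" for y
  proof -
    have y: "y \<in> carrier H"
      using that A by blast
    have un: "u n \<in> carrier H" "cinner H (u n) y = 0" for n
      using u that by (auto simp: orthogonal_complement_def subset_iff)
    have "cmod (cinner H x y) \<le> hnorm H (u n \<ominus> x) * hnorm H y" for n
      using Cauchy_Schwarz[of "u n \<ominus> x" y] un[of n] x y by (simp add: cinner_diff_left)
    moreover have "(\<lambda>n. hnorm H (u n \<ominus> x) * hnorm H y) \<longlonglongrightarrow> 0"
      using tendsto_mult_right[OF lim, of "hnorm H y"] by simp
    ultimately have "cmod (cinner H x y) \<le> 0"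
      by (intro LIMSEQ_le_const) auto
    then show ?thesis
      by simp
  qed
  then show ?thesis
    using x by (simp add: orthogonal_complement_def)
qed

text \<open>
  A linear map \<open>J\<close> that is injective on a closed subspace transports the Hilbert space structure
  to the image of this subspace.  Taking the subspace to be an orthogonal complement gives
  its closedness at once from the Cauchy-Schwarz inequality.
\<close>

lemma hilbert_space_image:
  fixes J :: "'v \<Rightarrow> 'i \<Rightarrow> complex"
  assumes A: "A \<subseteq> carrier H"
    and J_add: "\<And>x y. \<lbrakk>x \<in> carrier H; y \<in> carrier H\<rbrakk> \<Longrightarrow> J (x \<oplus> y) = (\<lambda>i. J x i + J y i)"
    and J_smult: "\<And>c x. x \<in> carrier H \<Longrightarrow> J (c \<odot> x) = (\<lambda>i. c * J x i)"
    and inj: "inj_on J (orthogonal_complement A)"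
  defines "M \<equiv> orthogonal_complement A"
  defines "H' \<equiv> fun_hilbert (J ` M) (\<lambda>f g. cinner H (inv_into M J f) (inv_into M J g))"
  shows "hilbert_space H'"
    and "\<And>x y. \<lbrakk>x \<in> M; y \<in> M\<rbrakk> \<Longrightarrow> hnorm H' (J x \<ominus>\<^bsub>H'\<^esub> J y) = hnorm H (x \<ominus> y)"
proof -
  let ?I = "inv_into M J"
  have I [simp]: "?I (J x) = x" if "x \<in> M" for x
    using inj that by (simp add: M_def)
  have M [dest]: "x \<in> carrier H" if "x \<in> M" for x
    using that by (simp add: M_def orthogonal_complement_def)
  have M_add: "x \<oplus> y \<in> M" if "x \<in> M" "y \<in> M" for x y
    using that A
    by (auto simp: M_def orthogonal_complement_def cinner_add_left subset_iff)
  have M_smult: "c \<odot> x \<in> M" if "x \<in> M" for x c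
    using that A
    by (auto simp: M_def orthogonal_complement_def cinner_smult_left subset_iff)
  have M_diff: "x \<ominus> y \<in> M" if "x \<in> M" "y \<in> M" for x y
    using orthogonal_complement_diff[OF A] that by (simp add: M_def)
  have M_zero: "\<zero> \<in> M"
    using A by (auto simp: M_def orthogonal_complement_def subset_iff)
  have J_zero: "J \<zero> = (\<lambda>i. 0)"
    using J_smult[of \<zero> 0] smult_l_null[of \<zero>] by (simp add: complex_ring_def)
  interpret function_space "J ` M"
  proof
    show "(\<lambda>x. 0) \<in> J ` M"
      using J_zero M_zero by force
    show "(\<lambda>x. f x + g x) \<in> J ` M" if "f \<in> J ` M" "g \<in> J ` M" for f g
      using that J_add M_add M by (auto simp: image_iff) (metis (full_types))
    show "(\<lambda>x. c * f x) \<in> J ` M" if "f \<in> J ` M" for f c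
      using that J_smult M_smult M by (auto simp: image_iff) (metis (full_types))
  qed
  have J_diff: "J (x \<ominus> y) = (\<lambda>i. J x i - J y i)" if "x \<in> M" "y \<in> M" for x y
  proof -
    have "J x = J ((x \<ominus> y) \<oplus> y)"
      using that by (simp add: M a_minus_def M.a_assoc M.l_neg)
    then show ?thesis
      using that by (simp add: J_add M)
  qed
  have Jm: "J x \<ominus>\<^bsub>H'\<^esub> J y = J (x \<ominus> y)" if "x \<in> M" "y \<in> M" for x y
    using that by (simp add: H'_def minus J_diff)
  have cin: "cinner H' (J x) (J y) = cinner H x y" if "x \<in> M" "y \<in> M" for x y
    using that by (simp add: H'_def)
  show norm: "hnorm H' (J x \<ominus>\<^bsub>H'\<^esub> J y) = hnorm H (x \<ominus> y)" if "x \<in> M" "y \<in> M" for x y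
    using that by (simp add: hnorm_def Jm cin M_diff)
  have J_add': "J x \<oplus>\<^bsub>H'\<^esub> J y = J (x \<oplus> y)" if "x \<in> M" "y \<in> M" for x y
    using that by (simp add: H'_def J_add M)
  have J_smult': "c \<odot>\<^bsub>H'\<^esub> J x = J (c \<odot> x)" if "x \<in> M" for x c
    using that by (simp add: H'_def J_smult M)
  have carrier: "carrier H' = J ` M"
    by (simp add: H'_def)
  show "hilbert_space H'"
  proof (intro hilbert_space.intro hilbert_space_axioms.intro)
    show "module complex_ring H'"
      unfolding H'_def by (rule module)
  next
    fix u :: "nat \<Rightarrow> 'i \<Rightarrow> complex"
    assume u: "range u \<subseteq> carrier H'"
      and Cauchy: "\<forall>e>0. \<exists>N. \<forall>m\<ge>N. \<forall>n\<ge>N. hnorm H' (u m \<ominus>\<^bsub>H'\<^esub> u n) < e"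
    define v where "v n = ?I (u n)" for n
    have v: "v n \<in> M" "u n = J (v n)" for n
      using u by (auto simp: v_def carrier inv_into_into f_inv_into_f subset_iff)
    then have "\<forall>e>0. \<exists>N. \<forall>m\<ge>N. \<forall>n\<ge>N. hnorm H (v m \<ominus> v n) < e"
      using Cauchy by (simp add: norm)
    then obtain x where x: "x \<in> carrier H" "(\<lambda>n. hnorm H (v n \<ominus> x)) \<longlonglongrightarrow> 0"
      using complete[of v] v(1) M by blast
    have "x \<in> M"
      unfolding M_def using orthogonal_complement_closed[OF A _ x] v(1) by (auto simp: M_def)
    then show "\<exists>f\<in>carrier H'. (\<lambda>n. hnorm H' (u n \<ominus>\<^bsub>H'\<^esub> f)) \<longlonglongrightarrow> 0"
      using x v by (auto simp: carrier norm)
  next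
    fix f assume "f \<in> carrier H'" "cinner H' f f = 0"
    then obtain x where x: "x \<in> M" "f = J x" "cinner H x x = 0"
      by (auto simp: carrier cin)
    then have "x = \<zero>"
      using cinner_eq_zero M by blast
    then show "f = \<zero>\<^bsub>H'\<^esub>"
      using x J_zero by (simp add: H'_def)
  qed (auto simp: carrier cin J_add' J_smult' M_add M_smult cinner_add_left cinner_smult_left M
      intro!: cinner_commute cinner_nonneg)
qed

end

text \<open>
  An almost invariant vector \<open>\<xi>\<close> in a representation on an arbitrary type has to be moved to the type
  of functions on lists over the group.  Let \<open>M\<close> be the double orthogonal complement of the orbit of
  \<open>\<xi>\<close>;  it is invariant and contains \<open>\<xi>\<close>.  A vector of \<open>M\<close> is determined by its matrix
  coefficients \<open>g \<mapsto> \<langle>x, g\<xi>\<rangle>\<close>:  if they vanish, \<open>x\<close> is orthogonal to the orbit and hence to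
  itself.  So \<open>M\<close> is isomorphic to a Hilbert space of functions on the group.  This avoids
  orthonormal bases and orthogonal projections.
\<close>

lemma kazhdan_pair_transfer:
  fixes G :: "('a, 'm) monoid_scheme" and K :: "('b, 'n) monoid_scheme"
  assumes G: "group G" and K: "group K" and h: "h \<in> iso G K" and Q: "Q \<subseteq> carrier G"
    and kazhdan: "kazhdan_pair TYPE('a list \<Rightarrow> complex) G Q \<epsilon>"
  shows "kazhdan_pair TYPE('v) K (h ` Q) \<epsilon>"
  unfolding kazhdan_pair_def
proof (intro allI impI, elim exE)
  fix H :: "'v hilbert" and \<pi> \<xi>
  assume rep: "unitary_representation K H \<pi>"
    and almost: "almost_invariant_vector H \<pi> (h ` Q) \<epsilon> \<xi>"
  interpret hilbert_space H
    using rep by (rule unitary_representation.axioms)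
  interpret U: group "unitary_group H"
    by (rule group_unitary_group)
  interpret G: group G
    by (rule G)
  define \<sigma> where "\<sigma> = \<pi> \<circ> h"
  have \<xi>: "\<xi> \<in> carrier H" "\<xi> \<noteq> \<zero>\<^bsub>H\<^esub>"
    using almost by (auto simp: almost_invariant_vector_def)
  have "\<sigma> \<in> hom G (unitary_group H)"
    using rep h unfolding \<sigma>_def unitary_representation_iff_hom[OF K hilbert_space_axioms]
    by (auto intro: Group.hom_compose simp: iso_def)
  then interpret \<sigma>: group_hom G "unitary_group H" \<sigma>
    by unfold_locales
  have \<sigma>: "\<sigma> g \<in> carrier (unitary_group H)" if "g \<in> carrier G" for g
    using that by simp
  have \<sigma>_closed: "\<sigma> g x \<in> carrier H" if "g \<in> carrier G" "x \<in> carrier H" for g x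
    using unitary_group_closed[OF \<sigma>] that by blast
  have \<sigma>_mult: "\<sigma> (g \<otimes>\<^bsub>G\<^esub> k) x = \<sigma> g (\<sigma> k x)"
    if "g \<in> carrier G" "k \<in> carrier G" "x \<in> carrier H" for g k x
    using that by (simp add: mult_unitary_group \<sigma> compose_eq)
  have \<sigma>_one: "\<one>\<^bsub>unitary_group H\<^esub> x = x" if "x \<in> carrier H" for x
    using that by (simp add: one_unitary_group)
  have \<sigma>_adjoint: "cinner H (\<sigma> g x) y = cinner H x (\<sigma> (inv\<^bsub>G\<^esub> g) y)"
    if "g \<in> carrier G" "x \<in> carrier H" "y \<in> carrier H" for g x y
  proof -
    have "cinner H (\<sigma> g x) y = cinner H (\<sigma> (inv\<^bsub>G\<^esub> g) (\<sigma> g x)) (\<sigma> (inv\<^bsub>G\<^esub> g) y)"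
      using that by (subst unitary_group_cinner[OF \<sigma>]) (auto simp: \<sigma>_closed)
    then show ?thesis
      using that by (simp flip: \<sigma>_mult add: \<sigma>_one del: \<sigma>.hom_inv)
  qed
  define Orb where "Orb = {\<sigma> g \<xi> | g. g \<in> carrier G}"
  have Orb: "Orb \<subseteq> carrier H"
    using \<xi> by (auto simp: Orb_def \<sigma>_closed)
  define A where "A = orthogonal_complement Orb"
  define M where "M = orthogonal_complement A"
  have A: "A \<subseteq> carrier H"
    by (auto simp: A_def orthogonal_complement_def)
  have M_carrier: "x \<in> carrier H" if "x \<in> M" for x
    using that by (simp add: M_def orthogonal_complement_def)
  have \<xi>M: "\<xi> \<in> M"
  proof -
    have "cinner H \<xi> w = 0" if "w \<in> A" for w
    proof -
      have "\<xi> \<in> Orb"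
        using \<sigma>_one[OF \<xi>(1)] \<sigma>.hom_one by (auto simp: Orb_def intro!: exI[of _ "\<one>\<^bsub>G\<^esub>"])
      then have "w \<in> carrier H" "cinner H w \<xi> = 0"
        using that by (auto simp: A_def orthogonal_complement_def)
      then show ?thesis
        using cinner_commute[OF \<xi>(1), of w] by simp
    qed
    then show ?thesis
      using \<xi> by (simp add: M_def orthogonal_complement_def)
  qed
  have A_inv: "\<sigma> g w \<in> A" if "g \<in> carrier G" "w \<in> A" for g w
  proof -
    have w: "w \<in> carrier H" "\<And>k. k \<in> carrier G \<Longrightarrow> cinner H w (\<sigma> k \<xi>) = 0"
      using that by (auto simp: A_def orthogonal_complement_def Orb_def)
    have "cinner H (\<sigma> g w) (\<sigma> k \<xi>) = 0" if "k \<in> carrier G" for k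
      using \<open>g \<in> carrier G\<close> that w \<xi>(1) w(2)[of "inv\<^bsub>G\<^esub> g \<otimes>\<^bsub>G\<^esub> k"]
      by (subst \<sigma>_adjoint) (auto simp: \<sigma>_closed \<sigma>_mult simp del: \<sigma>.hom_mult)
    then show ?thesis
      using that w by (auto simp: A_def orthogonal_complement_def Orb_def \<sigma>_closed)
  qed
  have M_inv: "\<sigma> g x \<in> M" if "g \<in> carrier G" "x \<in> M" for g x
    using that A A_inv[of "inv\<^bsub>G\<^esub> g"]
    by (auto simp: M_def orthogonal_complement_def \<sigma>_closed \<sigma>_adjoint subset_iff
        simp del: \<sigma>.hom_inv)
  \<comment> \<open>Only the head of a list matters;  the singletons suffice for injectivity.\<close>
  define J :: "'v \<Rightarrow> 'a list \<Rightarrow> complex"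
    where "J x = (\<lambda>l. if hd l \<in> carrier G then cinner H x (\<sigma> (hd l) \<xi>) else 0)" for x
  have J_add: "J (x \<oplus>\<^bsub>H\<^esub> y) = (\<lambda>i. J x i + J y i)" if "x \<in> carrier H" "y \<in> carrier H" for x y
    using that \<xi> by (auto simp: J_def fun_eq_iff cinner_add_left \<sigma>_closed)
  have J_smult: "J (c \<odot>\<^bsub>H\<^esub> x) = (\<lambda>i. c * J x i)" if "x \<in> carrier H" for c x
    using that \<xi> by (auto simp: J_def fun_eq_iff cinner_smult_left \<sigma>_closed)
  have inj: "inj_on J M"
  proof (rule inj_onI)
    fix x y assume xy: "x \<in> M" "y \<in> M" "J x = J y"
    have c: "x \<in> carrier H" "y \<in> carrier H"
      using xy M_carrier by auto
    have "x \<ominus>\<^bsub>H\<^esub> y \<in> M"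
      unfolding M_def by (rule orthogonal_complement_diff[OF A]) (use xy in \<open>auto simp: M_def\<close>)
    moreover have "cinner H (x \<ominus>\<^bsub>H\<^esub> y) (\<sigma> g \<xi>) = 0" if "g \<in> carrier G" for g
      using fun_cong[OF xy(3), of "[g]"] that c \<xi> by (simp add: J_def cinner_diff_left \<sigma>_closed)
    then have "x \<ominus>\<^bsub>H\<^esub> y \<in> A"
      using c by (auto simp: A_def orthogonal_complement_def Orb_def)
    ultimately have "cinner H (x \<ominus>\<^bsub>H\<^esub> y) (x \<ominus>\<^bsub>H\<^esub> y) = 0"
      by (simp add: M_def orthogonal_complement_def)
    then show "x = y"
      using c by (simp add: cinner_eq_zero diff_eq_zero)
  qed
  define I where "I = inv_into M J"
  have I [simp]: "I (J x) = x" if "x \<in> M" for x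
    using inj that by (simp add: I_def)
  define H' where "H' = fun_hilbert (J ` M) (\<lambda>f g. cinner H (I f) (I g))"
  have H': "hilbert_space H'"
    and norm: "\<And>x y. \<lbrakk>x \<in> M; y \<in> M\<rbrakk> \<Longrightarrow> hnorm H' (J x \<ominus>\<^bsub>H'\<^esub> J y) = hnorm H (x \<ominus>\<^bsub>H\<^esub> y)"
    unfolding H'_def I_def M_def
    by (rule hilbert_space_image[where J = J, OF A J_add J_smult inj[unfolded M_def]], assumption+)+
  interpret H': hilbert_space H'
    by (rule H')
  have H'_simps: "carrier H' = J ` M" "\<zero>\<^bsub>H'\<^esub> = (\<lambda>x. 0)"
    "\<And>x y. \<lbrakk>x \<in> M; y \<in> M\<rbrakk> \<Longrightarrow> cinner H' (J x) (J y) = cinner H x y"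
    by (simp_all add: H'_def)
  have J_add': "J x \<oplus>\<^bsub>H'\<^esub> J y = J (x \<oplus>\<^bsub>H\<^esub> y)" if "x \<in> M" "y \<in> M" for x y
    using that by (simp add: H'_def J_add M_carrier)
  have J_smult': "c \<odot>\<^bsub>H'\<^esub> J x = J (c \<odot>\<^bsub>H\<^esub> x)" if "x \<in> M" for x c
    using that by (simp add: H'_def J_smult M_carrier)
  have M_add: "x \<oplus>\<^bsub>H\<^esub> y \<in> M" if "x \<in> M" "y \<in> M" for x y
    using that A
    by (auto simp: M_def orthogonal_complement_def cinner_add_left subset_iff)
  have M_smult: "c \<odot>\<^bsub>H\<^esub> x \<in> M" if "x \<in> M" for x c
    using that A
    by (auto simp: M_def orthogonal_complement_def cinner_smult_left subset_iff)
  define \<rho> where "\<rho> g = restrict (\<lambda>f. J (\<sigma> g (I f))) (carrier H')" for g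
  have \<rho>J: "\<rho> g (J x) = J (\<sigma> g x)" if "x \<in> M" for g x
    using that by (simp add: \<rho>_def H'_simps)
  have \<rho>: "\<rho> g \<in> carrier (unitary_group H')" if g: "g \<in> carrier G" for g
    unfolding \<rho>_def
  proof (rule restrict_in_unitary_group[where T' = "\<lambda>f. J (\<sigma> (inv\<^bsub>G\<^esub> g) (I f))"])
    fix f assume "f \<in> carrier H'"
    then show "J (\<sigma> g (I f)) \<in> carrier H' \<and> J (\<sigma> (inv\<^bsub>G\<^esub> g) (I f)) \<in> carrier H' \<and>
        J (\<sigma> g (I (J (\<sigma> (inv\<^bsub>G\<^esub> g) (I f))))) = f \<and>
        J (\<sigma> (inv\<^bsub>G\<^esub> g) (I (J (\<sigma> g (I f))))) = f"
      using g by (auto simp: H'_simps M_inv M_carrier \<sigma>_one simp del: \<sigma>.hom_inv simp flip: \<sigma>_mult)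
  qed (use g in \<open>auto simp: H'_simps J_add' J_smult' M_inv M_add M_smult M_carrier
        unitary_group_add[OF \<sigma>] unitary_group_smult[OF \<sigma>] unitary_group_cinner[OF \<sigma>]\<close>)
  have "\<rho> \<in> hom G (unitary_group H')"
  proof (rule homI)
    fix g k assume gk: "g \<in> carrier G" "k \<in> carrier G"
    interpret U': group "unitary_group H'"
      by (rule H'.group_unitary_group)
    show "\<rho> (g \<otimes>\<^bsub>G\<^esub> k) = \<rho> g \<otimes>\<^bsub>unitary_group H'\<^esub> \<rho> k"
    proof (rule unitary_group_eqI[of _ H'])
      fix f assume "f \<in> carrier H'"
      then show "\<rho> (g \<otimes>\<^bsub>G\<^esub> k) f = (\<rho> g \<otimes>\<^bsub>unitary_group H'\<^esub> \<rho> k) f"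
        using gk by (auto simp: \<rho> H'_simps \<rho>J \<sigma>_mult M_carrier M_inv mult_unitary_group
            compose_eq simp del: \<sigma>.hom_mult)
    qed (use gk in \<open>auto simp: \<rho>\<close>)
  qed (rule \<rho>)
  then have rep': "unitary_representation G H' \<rho>"
    by (simp add: unitary_representation_iff_hom[OF G H'])
  have "almost_invariant_vector H' \<rho> Q \<epsilon> (J \<xi>)"
    unfolding almost_invariant_vector_def
  proof (intro conjI ballI)
    show "J \<xi> \<in> carrier H'"
      using \<xi>M by (simp add: H'_simps)
    have "J \<zero>\<^bsub>H\<^esub> = (\<lambda>x. 0)"
      by (auto simp: J_def \<sigma>_closed \<xi>)
    moreover have "\<zero>\<^bsub>H\<^esub> \<in> M"
      using A by (auto simp: M_def orthogonal_complement_def subset_iff)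
    ultimately show "J \<xi> \<noteq> \<zero>\<^bsub>H'\<^esub>"
      using inj_onD[OF inj, of \<xi> "\<zero>\<^bsub>H\<^esub>"] \<xi>M \<xi>(2) by (auto simp: H'_simps)
    fix g assume g: "g \<in> Q"
    then have "hnorm H (\<sigma> g \<xi> \<ominus>\<^bsub>H\<^esub> \<xi>) < \<epsilon> * hnorm H \<xi>"
      using almost by (auto simp: almost_invariant_vector_def \<sigma>_def)
    moreover have "hnorm H' (J \<xi>) = hnorm H \<xi>"
      using \<xi>M by (simp add: hnorm_def H'_simps)
    ultimately show "hnorm H' (\<rho> g (J \<xi>) \<ominus>\<^bsub>H'\<^esub> J \<xi>) < \<epsilon> * hnorm H' (J \<xi>)"
      using g Q \<xi>M by (subst \<rho>J) (auto simp: norm M_inv subset_iff)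
  qed
  then obtain f where f: "nonzero_invariant_vector G H' \<rho> f"
    using kazhdan rep' unfolding kazhdan_pair_def by blast
  then obtain x where x: "x \<in> M" "f = J x"
    by (auto simp: nonzero_invariant_vector_def H'_simps)
  have fixed: "\<sigma> g x = x" if "g \<in> carrier G" for g
    using f x that inj M_inv by (auto simp: nonzero_invariant_vector_def \<rho>J dest: inj_onD)
  have "x \<noteq> \<zero>\<^bsub>H\<^esub>"
    using f x by (auto simp: nonzero_invariant_vector_def H'_simps J_def \<sigma>_closed \<xi>)
  moreover have "\<pi> k x = x" if "k \<in> carrier K" for k
  proof -
    obtain g where "g \<in> carrier G" "k = h g"
      using h \<open>k \<in> carrier K\<close> by (auto simp: iso_def bij_betw_def)
    then show ?thesis
      using fixed by (simp add: \<sigma>_def)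
  qed
  ultimately show "\<exists>x. nonzero_invariant_vector K H \<pi> x"
    using x M_carrier by (auto simp: nonzero_invariant_vector_def)
qed

lemma property_T_iso:
  fixes G :: "('a, 'm) monoid_scheme" and K :: "('b, 'n) monoid_scheme"
  assumes "group G" "group K" "G \<cong> K" "property_T G"
  shows "property_T K"
proof -
  obtain h where h: "h \<in> iso G K"
    using assms(3) by (auto simp: is_iso_def)
  obtain Q \<epsilon> where Q: "finite Q" "Q \<subseteq> carrier G" "\<epsilon> > 0"
      "kazhdan_pair TYPE('a list \<Rightarrow> complex) G Q \<epsilon>"
    using assms(4) by (auto simp: property_T_def)
  have "kazhdan_pair TYPE('b list \<Rightarrow> complex) K (h ` Q) \<epsilon>"
    by (rule kazhdan_pair_transfer[OF assms(1,2) h Q(2,4)])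
  moreover have "h ` Q \<subseteq> carrier K"
    using h Q(2) by (auto simp: iso_def hom_def)
  ultimately show ?thesis
    using Q by (auto simp: property_T_def intro!: exI[of _ "h ` Q"] exI[of _ \<epsilon>])
qed

section \<open>Homomorphisms out of presented groups\<close>

text \<open>
  The extension of a map from the generators to a group \<open>M\<close> to words, reduced or not.
\<close>

definition letter_value :: "('g, 'm) monoid_scheme \<Rightarrow> ('x \<Rightarrow> 'g) \<Rightarrow> 'x \<times> bool \<Rightarrow> 'g" where
  "letter_value M f a = (if snd a then f (fst a) else inv\<^bsub>M\<^esub> (f (fst a)))"

definition word_value :: "('g, 'm) monoid_scheme \<Rightarrow> ('x \<Rightarrow> 'g) \<Rightarrow> 'x word \<Rightarrow> 'g" where
  "word_value M f w = foldr (\<lambda>a g. letter_value M f a \<otimes>\<^bsub>M\<^esub> g) w \<one>\<^bsub>M\<^esub>"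

lemma word_value_simps [simp]:
  "word_value M f [] = \<one>\<^bsub>M\<^esub>"
  "word_value M f (a # w) = letter_value M f a \<otimes>\<^bsub>M\<^esub> word_value M f w"
  by (simp_all add: word_value_def)

lemma carrier_free_group: "w \<in> carrier (free_group X) \<longleftrightarrow> fst ` set w \<subseteq> X \<and> reduced_word w"
  by (simp add: free_group_def)

lemma mult_free_group: "u \<otimes>\<^bsub>free_group X\<^esub> v = foldr reduced_Cons u v"
  by (simp add: free_group_def)

lemma one_free_group [simp]: "\<one>\<^bsub>free_group X\<^esub> = []"
  by (simp add: free_group_def)

lemma generator_in_free_group [simp]: "[(x, b)] \<in> carrier (free_group X) \<longleftrightarrow> x \<in> X"
  by (simp add: carrier_free_group reduced_word_def)

lemma free_group_mono: "X \<subseteq> Y \<Longrightarrow> carrier (free_group X) \<subseteq> carrier (free_group Y)"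
  unfolding subset_iff carrier_free_group by blast

lemma inv_generator: "x \<in> X \<Longrightarrow> inv\<^bsub>free_group X\<^esub> [(x, True)] = [(x, False)]"
  by (rule group.inv_equality[OF group_free_group])
     (auto simp: mult_free_group inv_letter_def)

context group
begin

lemma letter_value_closed [simp]:
  "\<lbrakk>f \<in> X \<rightarrow> carrier G; fst a \<in> X\<rbrakk> \<Longrightarrow> letter_value G f a \<in> carrier G"
  by (auto simp: letter_value_def)

lemma word_value_closed [simp]:
  "\<lbrakk>f \<in> X \<rightarrow> carrier G; fst ` set w \<subseteq> X\<rbrakk> \<Longrightarrow> word_value G f w \<in> carrier G"
  by (induction w) auto

lemma letter_value_inv_letter:
  assumes "f \<in> X \<rightarrow> carrier G" "fst a \<in> X"
  shows "letter_value G f a \<otimes> letter_value G f (inv_letter a) = \<one>"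
  using assms by (auto simp: letter_value_def inv_letter_def Pi_iff)

lemma word_value_reduced_Cons:
  assumes f: "f \<in> X \<rightarrow> carrier G" and "fst a \<in> X" "fst ` set w \<subseteq> X"
  shows "word_value G f (reduced_Cons a w) = letter_value G f a \<otimes> word_value G f w"
proof (cases w)
  case (Cons b v)
  then show ?thesis
    using assms letter_value_inv_letter[OF f, of a]
    by (auto simp: m_assoc[symmetric] letter_value_closed[OF f] word_value_closed[OF f])
qed (use assms in simp)

lemma word_value_hom:
  assumes f: "f \<in> X \<rightarrow> carrier G"
  shows "word_value G f \<in> hom (free_group X) G"
proof (rule homI)
  fix u v assume u: "u \<in> carrier (free_group X)" and "v \<in> carrier (free_group X)"
  then have v: "fst ` set v \<subseteq> X"
    by (simp add: carrier_free_group)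
  have "fst ` set u \<subseteq> X"
    using u by (simp add: carrier_free_group)
  then show "word_value G f (u \<otimes>\<^bsub>free_group X\<^esub> v) = word_value G f u \<otimes> word_value G f v"
    unfolding mult_free_group
  proof (induction u)
    case (Cons a u)
    have "fst ` set (foldr reduced_Cons u v) \<subseteq> X"
      using Cons.prems v set_foldr_reduced_Cons[of u v] by fastforce
    then show ?case
      using Cons v
      by (simp add: word_value_reduced_Cons[OF f] m_assoc letter_value_closed[OF f]
          word_value_closed[OF f])
  qed (use v f in simp)
qed (use f in \<open>simp add: carrier_free_group\<close>)

lemma word_value_generator: "f x \<in> carrier G \<Longrightarrow> word_value G f [(x, True)] = f x"
  by (simp add: letter_value_def)

lemma word_value_cong:
  assumes "\<And>x. x \<in> X \<Longrightarrow> f x = g x" "fst ` set w \<subseteq> X"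
  shows "word_value G f w = word_value G g w"
  using assms(2) by (induction w) (auto simp: assms(1) letter_value_def)

lemma word_value_one: "(\<And>x. x \<in> fst ` set w \<Longrightarrow> f x = \<one>) \<Longrightarrow> word_value G f w = \<one>"
  by (induction w) (auto simp: letter_value_def)

lemma hom_free_group_eq:
  assumes h: "h \<in> hom (free_group X) G" and w: "w \<in> carrier (free_group X)"
  shows "h w = word_value G (\<lambda>x. h [(x, True)]) w"
proof -
  interpret F: group "free_group X"
    by (rule group_free_group)
  interpret h: group_hom "free_group X" G h
    using h by unfold_locales
  from w show ?thesis
  proof (induction w)
    case Nil
    show ?case
      using h.hom_one by simp
  next
    case (Cons a w)
    then have w: "w \<in> carrier (free_group X)" and a: "fst a \<in> X"
      by (auto simp: carrier_free_group reduced_word_def successively_Cons)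
    have "reduced_Cons a w = a # w"
      using Cons.prems by (cases w) (auto simp: carrier_free_group reduced_word_def)
    then have "a # w = [a] \<otimes>\<^bsub>free_group X\<^esub> w"
      by (simp add: mult_free_group)
    moreover have "[a] \<in> carrier (free_group X)"
      using a by (cases a) simp
    ultimately have "h (a # w) = h [a] \<otimes> h w"
      using w by (metis h.hom_mult)
    moreover have "h [a] = letter_value G (\<lambda>x. h [(x, True)]) a"
      using a h.hom_inv[of "[(fst a, True)]"]
      by (cases a) (auto simp: letter_value_def inv_generator)
    ultimately show ?case
      using Cons.IH[OF w] by simp
  qed
qed

end

definition presented_class :: "'x set \<Rightarrow> 'x word set \<Rightarrow> 'x word \<Rightarrow> 'x word set" where
  "presented_class X R w = normal_closure (free_group X) R #>\<^bsub>free_group X\<^esub> w"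

context
  fixes X :: "'x set" and R
  assumes R: "R \<subseteq> carrier (free_group X)"
begin

interpretation F: group "free_group X"
  by (rule group_free_group)

interpretation N: normal "normal_closure (free_group X) R" "free_group X"
  by (rule normal_normal_closure[OF group_free_group R])

lemma presented_class_hom: "presented_class X R \<in> hom (free_group X) (presented_group X R)"
  using N.r_coset_hom_Mod by (simp add: presented_class_def[abs_def] presented_group_def)

lemma carrier_presented_group:
  "carrier (presented_group X R) = presented_class X R ` carrier (free_group X)"
  by (simp add: presented_group_def carrier_FactGroup presented_class_def[abs_def])

lemma presented_class_eq_one:
  assumes "w \<in> carrier (free_group X)"
  shows "presented_class X R w = \<one>\<^bsub>presented_group X R\<^esub> \<longleftrightarrow> w \<in> normal_closure (free_group X) R"
  using assms F.coset_join1[OF _ _ N.subgroup_axioms] F.coset_join2[OF _ N.subgroup_axioms] N.subset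
  by (auto simp: presented_class_def presented_group_def)

lemma presented_class_relator: "r \<in> R \<Longrightarrow> presented_class X R r = \<one>\<^bsub>presented_group X R\<^esub>"
  using R by (simp add: presented_class_eq_one subset_iff normal_closure_def hull_inc)

lemma presented_group_universal:
  assumes M: "group M" and h: "h \<in> hom (free_group X) M" and "\<And>r. r \<in> R \<Longrightarrow> h r = \<one>\<^bsub>M\<^esub>"
  obtains g where "g \<in> hom (presented_group X R) M"
    and "\<And>w. w \<in> carrier (free_group X) \<Longrightarrow> g (presented_class X R w) = h w"
proof -
  interpret h: group_hom "free_group X" M h
    using M h by (simp add: group_hom_def group_hom_axioms_def F.group_axioms)
  have "R \<subseteq> kernel (free_group X) M h"
    using R assms(3) by (auto simp: kernel_def)
  then have "normal_closure (free_group X) R \<subseteq> kernel (free_group X) M h"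
    unfolding normal_closure_def by (intro hull_minimal h.normal_kernel)
  from h.FactGroup_universal_kernel[OF N.normal_axioms this] show ?thesis
    using that by (auto simp: presented_group_def presented_class_def)
qed

end

section \<open>Representations that rule out Property (T)\<close>

context hilbert_space
begin

lemma hnorm_diff_commute:
  assumes "x \<in> carrier H" "y \<in> carrier H"
  shows "hnorm H (x \<ominus> y) = hnorm H (y \<ominus> x)"
proof -
  have "cinner H (x \<ominus> y) (x \<ominus> y) = cinner H (y \<ominus> x) (y \<ominus> x)"
    using assms by (simp add: cinner_diff_left cinner_diff_right)
  then show ?thesis
    by (simp add: hnorm_def)
qed

lemma hnorm_unitary_diff:
  assumes T: "T \<in> carrier (unitary_group H)" and xy: "x \<in> carrier H" "y \<in> carrier H"
  shows "hnorm H (T x \<ominus> T y) = hnorm H (x \<ominus> y)"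
proof -
  note T' = unitary_groupD[OF T]
  have "cinner H (T x \<ominus> T y) (T x \<ominus> T y) = cinner H (x \<ominus> y) (x \<ominus> y)"
    using xy by (simp add: T' cinner_diff_left cinner_diff_right)
  then show ?thesis
    by (simp add: hnorm_def)
qed

text \<open>
  Unitary operators preserve distances, so the displacement of a vector is subadditive
  under products and invariant under inversion.
\<close>

lemma hnorm_word_displacement:
  assumes \<rho>: "\<rho> \<in> X \<rightarrow> carrier (unitary_group H)" and \<xi>: "\<xi> \<in> carrier H"
    and \<delta>: "\<And>x. x \<in> X \<Longrightarrow> hnorm H (\<rho> x \<xi> \<ominus> \<xi>) \<le> \<delta>"
    and w: "fst ` set w \<subseteq> X"
  shows "hnorm H (word_value (unitary_group H) \<rho> w \<xi> \<ominus> \<xi>) \<le> real (length w) * \<delta>"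
  using w
proof (induction w)
  case Nil
  then show ?case
    using \<xi> by (simp add: one_unitary_group a_minus_def M.r_neg)
next
  case (Cons a w)
  interpret U: group "unitary_group H"
    by (rule group_unitary_group)
  define T where "T = letter_value (unitary_group H) \<rho> a"
  define S where "S = word_value (unitary_group H) \<rho> w"
  have a: "fst a \<in> X" and w: "fst ` set w \<subseteq> X"
    using Cons.prems by auto
  have T: "T \<in> carrier (unitary_group H)" and S: "S \<in> carrier (unitary_group H)"
    using U.letter_value_closed[OF \<rho> a] U.word_value_closed[OF \<rho> w] by (auto simp: T_def S_def)
  have c: "T \<xi> \<in> carrier H" "S \<xi> \<in> carrier H" "T (S \<xi>) \<in> carrier H"
    using \<xi> unitary_group_closed[OF T] unitary_group_closed[OF S] by auto
  have "hnorm H (T \<xi> \<ominus> \<xi>) \<le> \<delta>"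
  proof (cases "snd a")
    case True
    then show ?thesis
      using \<delta>[OF a] by (simp add: T_def letter_value_def)
  next
    case False
    define P where "P = \<rho> (fst a)"
    have P: "P \<in> carrier (unitary_group H)"
      using \<rho> a by (auto simp: P_def)
    have TP: "T = inv\<^bsub>unitary_group H\<^esub> P"
      using False by (simp add: T_def letter_value_def P_def)
    have P\<xi>: "P \<xi> \<in> carrier H"
      using unitary_group_closed[OF P \<xi>] .
    have "hnorm H (T \<xi> \<ominus> \<xi>) = hnorm H (T \<xi> \<ominus> T (P \<xi>))"
      using inv_unitary_group[OF P \<xi>] by (simp add: TP)
    also have "\<dots> = hnorm H (P \<xi> \<ominus> \<xi>)"
      using hnorm_unitary_diff[OF T \<xi> P\<xi>] hnorm_diff_commute[OF \<xi> P\<xi>] by simp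
    finally show ?thesis
      using \<delta>[OF a] by (simp add: P_def)
  qed
  moreover have "hnorm H (T (S \<xi>) \<ominus> T \<xi>) \<le> real (length w) * \<delta>"
    using Cons.IH[OF w] hnorm_unitary_diff[OF T c(2) \<xi>] by (simp add: S_def)
  moreover have "hnorm H (T (S \<xi>) \<ominus> \<xi>) \<le> hnorm H (T (S \<xi>) \<ominus> T \<xi>) + hnorm H (T \<xi> \<ominus> \<xi>)"
    using c \<xi> by (intro hnorm_diff_triangle)
  moreover have "word_value (unitary_group H) \<rho> (a # w) \<xi> = T (S \<xi>)"
    using \<xi> mult_unitary_group[OF T S] by (simp add: T_def S_def compose_eq)
  ultimately show ?case
    by (simp add: algebra_simps)
qed

end

text \<open>
  It suffices to control the generators:  for a given finite set \<open>Q\<close> of group elements, a vector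
  displaced by at most \<open>\<delta>\<close> by each generator is displaced by at most \<open>n \<delta>\<close> by each element of
  \<open>Q\<close>, where \<open>n\<close> bounds the lengths of words for these elements.
\<close>

lemma not_property_T_presented_group:
  fixes X :: "'x set"
  assumes R: "R \<subseteq> carrier (free_group X)"
    and deform: "\<And>\<delta>. \<delta> > 0 \<Longrightarrow> \<exists>(H :: 'v hilbert) \<rho> \<xi>. hilbert_space H \<and>
      \<rho> \<in> X \<rightarrow> carrier (unitary_group H) \<and>
      (\<forall>r\<in>R. word_value (unitary_group H) \<rho> r = \<one>\<^bsub>unitary_group H\<^esub>) \<and>
      \<xi> \<in> carrier H \<and> \<xi> \<noteq> \<zero>\<^bsub>H\<^esub> \<and>
      (\<forall>x\<in>X. hnorm H (\<rho> x \<xi> \<ominus>\<^bsub>H\<^esub> \<xi>) \<le> \<delta> * hnorm H \<xi>) \<and>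
      (\<forall>v\<in>carrier H. (\<forall>x\<in>X. \<rho> x v = v) \<longrightarrow> v = \<zero>\<^bsub>H\<^esub>)"
  shows "\<not> property_T (presented_group X R)"
proof
  let ?P = "presented_group X R"
  assume "property_T ?P"
  then obtain Q \<epsilon> where Q: "finite Q" "Q \<subseteq> carrier ?P" and \<epsilon>: "\<epsilon> > 0"
    and "kazhdan_pair TYPE('x word set list \<Rightarrow> complex) ?P Q \<epsilon>"
    by (auto simp: property_T_def)
  moreover have P: "group ?P"
    using R by (rule group_presented_group)
  ultimately have kazhdan: "kazhdan_pair TYPE('v) ?P Q \<epsilon>"
    using kazhdan_pair_transfer[OF P P iso_set_refl, of Q \<epsilon>] by simp
  have "\<forall>q\<in>Q. \<exists>w\<in>carrier (free_group X). q = presented_class X R w"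
    using Q(2) carrier_presented_group[OF R] by blast
  then obtain word where word:
    "\<And>q. q \<in> Q \<Longrightarrow> word q \<in> carrier (free_group X) \<and> q = presented_class X R (word q)"
    by metis
  define L where "L = (\<Sum>q\<in>Q. length (word q))"
  define \<delta> where "\<delta> = \<epsilon> / (real L + 1)"
  have "\<delta> > 0"
    using \<epsilon> by (simp add: \<delta>_def add_nonneg_pos)
  from deform[OF this] obtain H :: "'v hilbert" and \<rho> \<xi> where H: "hilbert_space H"
    and \<rho>: "\<rho> \<in> X \<rightarrow> carrier (unitary_group H)"
    and relators: "\<And>r. r \<in> R \<Longrightarrow> word_value (unitary_group H) \<rho> r = \<one>\<^bsub>unitary_group H\<^esub>"
    and \<xi>: "\<xi> \<in> carrier H" "\<xi> \<noteq> \<zero>\<^bsub>H\<^esub>"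
    and small: "\<And>x. x \<in> X \<Longrightarrow> hnorm H (\<rho> x \<xi> \<ominus>\<^bsub>H\<^esub> \<xi>) \<le> \<delta> * hnorm H \<xi>"
    and no_fixed: "\<And>v. \<lbrakk>v \<in> carrier H; \<And>x. x \<in> X \<Longrightarrow> \<rho> x v = v\<rbrakk> \<Longrightarrow> v = \<zero>\<^bsub>H\<^esub>"
    by auto
  interpret hilbert_space H
    by (rule H)
  interpret U: group "unitary_group H"
    by (rule group_unitary_group)
  obtain \<pi> where \<pi>: "\<pi> \<in> hom ?P (unitary_group H)"
    and \<pi>_class: "\<And>w. w \<in> carrier (free_group X) \<Longrightarrow>
      \<pi> (presented_class X R w) = word_value (unitary_group H) \<rho> w"
    using presented_group_universal[OF R U.group_axioms U.word_value_hom[OF \<rho>]] relators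
    by blast
  have rep: "unitary_representation ?P H \<pi>"
    using \<pi> by (simp add: unitary_representation_iff_hom[OF P H])
  have pos: "hnorm H \<xi> > 0"
    using \<xi> hnorm_eq_zero hnorm_nonneg by (metis less_eq_real_def)
  have "hnorm H (\<pi> q \<xi> \<ominus>\<^bsub>H\<^esub> \<xi>) < \<epsilon> * hnorm H \<xi>" if q: "q \<in> Q" for q
  proof -
    have "\<pi> q = word_value (unitary_group H) \<rho> (word q)"
      using word[OF q] \<pi>_class by metis
    then have "hnorm H (\<pi> q \<xi> \<ominus>\<^bsub>H\<^esub> \<xi>) \<le> real (length (word q)) * (\<delta> * hnorm H \<xi>)"
      using hnorm_word_displacement[OF \<rho> \<xi>(1) small, of "word q"] word[OF q]
      by (simp add: carrier_free_group)
    also have "length (word q) \<le> L"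
      unfolding L_def using Q(1) q by (intro member_le_sum) auto
    then have "real (length (word q)) * (\<delta> * hnorm H \<xi>) \<le> real L * (\<delta> * hnorm H \<xi>)"
      using \<open>\<delta> > 0\<close> pos by (intro mult_right_mono) auto
    also have "\<dots> < (real L + 1) * (\<delta> * hnorm H \<xi>)"
      using \<open>\<delta> > 0\<close> pos by simp
    also have "\<dots> = \<epsilon> * hnorm H \<xi>"
      by (simp add: \<delta>_def field_simps)
    finally show ?thesis
      by simp
  qed
  then have "almost_invariant_vector H \<pi> Q \<epsilon> \<xi>"
    using \<xi> by (simp add: almost_invariant_vector_def)
  then obtain v where v: "nonzero_invariant_vector ?P H \<pi> v"
    using kazhdan rep unfolding kazhdan_pair_def by blast
  have "\<rho> x v = v" if "x \<in> X" for x
  proof -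
    have "\<pi> (presented_class X R [(x, True)]) = \<rho> x"
      using that \<rho> U.word_value_generator[of \<rho> x] by (subst \<pi>_class) auto
    moreover have "presented_class X R [(x, True)] \<in> carrier ?P"
      using that by (simp add: carrier_presented_group[OF R])
    ultimately show ?thesis
      using v by (auto simp: nonzero_invariant_vector_def)
  qed
  then show False
    using no_fixed[of v] v by (auto simp: nonzero_invariant_vector_def)
qed

section \<open>Square-summable functions\<close>

text \<open>
  The index set \<open>S\<close> need not be a whole type;  functions are extended by \<open>0\<close>.
\<close>

definition l2_functions :: "'i set \<Rightarrow> ('i \<Rightarrow> complex) set" where
  "l2_functions S = {f. (\<forall>x. x \<notin> S \<longrightarrow> f x = 0) \<and> (\<lambda>x. (cmod (f x))\<^sup>2) summable_on UNIV}"

definition l2_space :: "'i set \<Rightarrow> ('i \<Rightarrow> complex) hilbert" where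
  "l2_space S = fun_hilbert (l2_functions S) (\<lambda>f g. \<Sum>\<^sub>\<infinity>x. f x * cnj (g x))"

lemma l2_space_simps [simp]:
  "carrier (l2_space S) = l2_functions S"
  "\<zero>\<^bsub>l2_space S\<^esub> = (\<lambda>x. 0)"
  "f \<oplus>\<^bsub>l2_space S\<^esub> g = (\<lambda>x. f x + g x)"
  "c \<odot>\<^bsub>l2_space S\<^esub> f = (\<lambda>x. c * f x)"
  "cinner (l2_space S) f g = (\<Sum>\<^sub>\<infinity>x. f x * cnj (g x))"
  by (simp_all add: l2_space_def)

lemma l2_mult_summable:
  assumes "f \<in> l2_functions S" "g \<in> l2_functions S"
  shows "(\<lambda>x. f x * cnj (g x)) summable_on UNIV"
proof (rule abs_summable_summable)
  have "(\<lambda>x. (cmod (f x))\<^sup>2 + (cmod (g x))\<^sup>2) summable_on UNIV"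
    using assms by (intro summable_on_add) (auto simp: l2_functions_def)
  moreover have "norm (f x * cnj (g x)) \<le> (cmod (f x))\<^sup>2 + (cmod (g x))\<^sup>2" for x
    using sum_squares_bound[of "cmod (f x)" "cmod (g x)"]
      mult_nonneg_nonneg[OF norm_ge_zero norm_ge_zero, of "f x" "g x"]
    unfolding norm_mult complex_mod_cnj by linarith
  ultimately show "(\<lambda>x. norm (f x * cnj (g x))) summable_on UNIV"
    by (rule Infinite_Sum.abs_summable_on_comparison_test')
qed

lemma function_space_l2: "function_space (l2_functions S)"
proof
  fix f g :: "'a \<Rightarrow> complex" assume fg: "f \<in> l2_functions S" "g \<in> l2_functions S"
  have "(\<lambda>x. 2 * ((cmod (f x))\<^sup>2 + (cmod (g x))\<^sup>2)) summable_on UNIV"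
    using fg by (intro summable_on_cmult_right summable_on_add) (auto simp: l2_functions_def)
  moreover have "(cmod (f x + g x))\<^sup>2 \<le> 2 * ((cmod (f x))\<^sup>2 + (cmod (g x))\<^sup>2)" for x
  proof -
    have "(cmod (f x + g x))\<^sup>2 \<le> (cmod (f x) + cmod (g x))\<^sup>2"
      by (intro power_mono norm_triangle_ineq) simp
    also have "\<dots> \<le> 2 * ((cmod (f x))\<^sup>2 + (cmod (g x))\<^sup>2)"
      using sum_squares_bound[of "cmod (f x)" "cmod (g x)"] by (simp add: power2_sum)
    finally show ?thesis .
  qed
  ultimately have "(\<lambda>x. (cmod (f x + g x))\<^sup>2) summable_on UNIV"
    by (rule summable_on_comparison_test) auto
  then show "(\<lambda>x. f x + g x) \<in> l2_functions S"
    using fg by (auto simp: l2_functions_def)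
next
  fix f :: "'a \<Rightarrow> complex" and c assume f: "f \<in> l2_functions S"
  then have "(\<lambda>x. (cmod c)\<^sup>2 * (cmod (f x))\<^sup>2) summable_on UNIV"
    by (intro summable_on_cmult_right) (simp add: l2_functions_def)
  then show "(\<lambda>x. c * f x) \<in> l2_functions S"
    using f by (simp add: l2_functions_def norm_mult power_mult_distrib)
qed (simp add: l2_functions_def)

lemma l2_minus:
  assumes "f \<in> l2_functions S" "g \<in> l2_functions S"
  shows "f \<ominus>\<^bsub>l2_space S\<^esub> g = (\<lambda>x. f x - g x)"
  using function_space.minus[OF function_space_l2 assms] by (simp add: l2_space_def)

lemma l2_cinner_self:
  assumes f: "f \<in> l2_functions S"
  shows "cinner (l2_space S) f f = complex_of_real (\<Sum>\<^sub>\<infinity>x. (cmod (f x))\<^sup>2)"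
proof -
  have "f x * cnj (f x) = complex_of_real ((cmod (f x))\<^sup>2)" for x
    by (simp flip: complex_norm_square)
  then have "cinner (l2_space S) f f = (\<Sum>\<^sub>\<infinity>x. complex_of_real ((cmod (f x))\<^sup>2))"
    by simp
  also have "\<dots> = complex_of_real (\<Sum>\<^sub>\<infinity>x. (cmod (f x))\<^sup>2)"
    using f by (intro infsumI has_sum_of_real has_sum_infsum) (simp add: l2_functions_def)
  finally show ?thesis .
qed

lemma l2_hnorm: "f \<in> l2_functions S \<Longrightarrow> hnorm (l2_space S) f = sqrt (\<Sum>\<^sub>\<infinity>x. (cmod (f x))\<^sup>2)"
  by (simp only: hnorm_def l2_cinner_self Re_complex_of_real)

lemma l2_finite_sum_le:
  assumes "f \<in> l2_functions S" "finite F"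
  shows "(\<Sum>x\<in>F. (cmod (f x))\<^sup>2) \<le> (hnorm (l2_space S) f)\<^sup>2"
  using assms finite_sum_le_infsum[of "\<lambda>x. (cmod (f x))\<^sup>2" UNIV F]
  by (simp add: l2_hnorm l2_functions_def infsum_nonneg)

lemma l2_bound:
  assumes supp: "\<And>x. x \<notin> S \<Longrightarrow> f x = 0" and "b \<ge> 0"
    and le: "\<And>F. finite F \<Longrightarrow> (\<Sum>x\<in>F. (cmod (f x))\<^sup>2) \<le> b\<^sup>2"
  shows "f \<in> l2_functions S" and "hnorm (l2_space S) f \<le> b"
proof -
  have "(\<lambda>x. (cmod (f x))\<^sup>2) summable_on UNIV"
    using le by (intro nonneg_bdd_above_summable_on) (auto intro: bdd_aboveI2[of _ _ "b\<^sup>2"])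
  then show "f \<in> l2_functions S"
    using supp by (simp add: l2_functions_def)
  have "(\<Sum>\<^sub>\<infinity>x. (cmod (f x))\<^sup>2) \<le> b\<^sup>2"
    using le \<open>(\<lambda>x. (cmod (f x))\<^sup>2) summable_on UNIV\<close> by (intro infsum_le_finite_sums)
  then have "sqrt (\<Sum>\<^sub>\<infinity>x. (cmod (f x))\<^sup>2) \<le> sqrt (b\<^sup>2)"
    by (rule real_sqrt_le_mono)
  then show "hnorm (l2_space S) f \<le> b"
    using \<open>b \<ge> 0\<close> \<open>f \<in> l2_functions S\<close> by (simp add: l2_hnorm)
qed

text \<open>
  A Cauchy sequence converges pointwise.  Every finite partial sum of the distance of \<open>u n\<close> to the
  pointwise limit \<open>f\<close> is a limit of partial sums of the distances of \<open>u n\<close> to \<open>u m\<close>, so the bound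
  on the latter carries over to \<open>f\<close>.
\<close>

lemma l2_complete:
  assumes u: "range u \<subseteq> l2_functions S"
    and Cauchy: "\<forall>e>0. \<exists>N. \<forall>m\<ge>N. \<forall>n\<ge>N. hnorm (l2_space S) (u m \<ominus>\<^bsub>l2_space S\<^esub> u n) < e"
  shows "\<exists>f\<in>l2_functions S. (\<lambda>n. hnorm (l2_space S) (u n \<ominus>\<^bsub>l2_space S\<^esub> f)) \<longlonglongrightarrow> 0"
proof -
  interpret function_space "l2_functions S"
    by (rule function_space_l2)
  have un: "u n \<in> l2_functions S" for n
    using u by blast
  have finite_le: "(\<Sum>x\<in>F. (cmod (u m x - u n x))\<^sup>2) \<le>
      (hnorm (l2_space S) (u m \<ominus>\<^bsub>l2_space S\<^esub> u n))\<^sup>2" if "finite F" for F m n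
    using l2_finite_sum_le[OF diff[OF un un] that] by (simp add: l2_minus un)
  have nonneg: "0 \<le> hnorm (l2_space S) f" if "f \<in> l2_functions S" for f
    using that by (simp add: l2_hnorm infsum_nonneg)
  have "\<exists>y. (\<lambda>n. u n x) \<longlonglongrightarrow> y" for x
  proof -
    have "Cauchy (\<lambda>n. u n x)"
      unfolding Cauchy_def
    proof (intro allI impI)
      fix e :: real assume "e > 0"
      then obtain N where
        N: "\<And>m n. \<lbrakk>m \<ge> N; n \<ge> N\<rbrakk> \<Longrightarrow> hnorm (l2_space S) (u m \<ominus>\<^bsub>l2_space S\<^esub> u n) < e"
        using Cauchy by meson
      have "dist (u m x) (u n x) < e" if "m \<ge> N" "n \<ge> N" for m n
      proof -
        have "cmod (u m x - u n x) \<le> hnorm (l2_space S) (u m \<ominus>\<^bsub>l2_space S\<^esub> u n)"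
          using finite_le[of "{x}" m n] nonneg[OF diff[OF un un]]
          by (simp add: l2_minus un power2_le_iff_abs_le)
        then show ?thesis
          using N[OF that] by (simp add: dist_norm)
      qed
      then show "\<exists>N. \<forall>m\<ge>N. \<forall>n\<ge>N. dist (u m x) (u n x) < e"
        by blast
    qed
    then show ?thesis
      using Cauchy_convergent_iff convergent_def by blast
  qed
  then obtain f where f: "\<And>x. (\<lambda>n. u n x) \<longlonglongrightarrow> f x"
    by metis
  have f_supp: "f x = 0" if "x \<notin> S" for x
  proof -
    have "u n x = 0" for n
      using un[of n] that by (simp add: l2_functions_def)
    then show ?thesis
      using f[of x] by (simp add: LIMSEQ_const_iff)
  qed
  have approx: "\<exists>N. \<forall>n\<ge>N. (\<lambda>x. u n x - f x) \<in> l2_functions S \<and>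
      hnorm (l2_space S) (\<lambda>x. u n x - f x) \<le> e" if "e > 0" for e
  proof -
    obtain N where
      N: "\<And>m n. \<lbrakk>m \<ge> N; n \<ge> N\<rbrakk> \<Longrightarrow> hnorm (l2_space S) (u m \<ominus>\<^bsub>l2_space S\<^esub> u n) < e"
      using Cauchy \<open>e > 0\<close> by meson
    have "(\<lambda>x. u n x - f x) \<in> l2_functions S \<and>
        hnorm (l2_space S) (\<lambda>x. u n x - f x) \<le> e" if n: "n \<ge> N" for n
    proof -
      have "(\<Sum>x\<in>F. (cmod (u n x - f x))\<^sup>2) \<le> e\<^sup>2" if F: "finite F" for F
      proof (rule LIMSEQ_le_const2)
        show "(\<lambda>m. \<Sum>x\<in>F. (cmod (u n x - u m x))\<^sup>2) \<longlonglongrightarrow> (\<Sum>x\<in>F. (cmod (u n x - f x))\<^sup>2)"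
          by (intro tendsto_intros f)
        have "(\<Sum>x\<in>F. (cmod (u n x - u m x))\<^sup>2) \<le> e\<^sup>2" if "m \<ge> N" for m
        proof -
          have "(hnorm (l2_space S) (u n \<ominus>\<^bsub>l2_space S\<^esub> u m))\<^sup>2 \<le> e\<^sup>2"
            using N[OF n that] nonneg[OF diff[OF un un]] by (intro power_mono) (auto simp: l2_minus un)
          then show ?thesis
            using finite_le[OF F, of n m] by linarith
        qed
        then show "\<exists>M. \<forall>m\<ge>M. (\<Sum>x\<in>F. (cmod (u n x - u m x))\<^sup>2) \<le> e\<^sup>2"
          by blast
      qed
      moreover have "u n x - f x = 0" if "x \<notin> S" for x
        using that f_supp un[of n] by (simp add: l2_functions_def)
      ultimately show ?thesis
        using l2_bound[of S "\<lambda>x. u n x - f x" e] \<open>e > 0\<close> by simp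
    qed
    then show ?thesis
      by blast
  qed
  obtain N where "(\<lambda>x. u N x - f x) \<in> l2_functions S"
    using approx[of 1] by auto
  then have fS: "f \<in> l2_functions S"
    using diff[OF un[of N]] by fastforce
  have "(\<lambda>n. hnorm (l2_space S) (u n \<ominus>\<^bsub>l2_space S\<^esub> f)) \<longlonglongrightarrow> 0"
  proof (rule LIMSEQ_I)
    fix r :: real assume "r > 0"
    then obtain N where
      N: "\<And>n. n \<ge> N \<Longrightarrow> hnorm (l2_space S) (\<lambda>x. u n x - f x) \<le> r / 2"
      using approx[of "r / 2"] by auto
    have "norm (hnorm (l2_space S) (u n \<ominus>\<^bsub>l2_space S\<^esub> f) - 0) < r" if "n \<ge> N" for n
    proof -
      have "hnorm (l2_space S) (\<lambda>x. u n x - f x) < r"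
        using N[OF that] \<open>r > 0\<close> by linarith
      then show ?thesis
        using nonneg[OF diff[OF un fS]] by (simp add: l2_minus un fS)
    qed
    then show "\<exists>N. \<forall>n\<ge>N. norm (hnorm (l2_space S) (u n \<ominus>\<^bsub>l2_space S\<^esub> f) - 0) < r"
      by blast
  qed
  then show ?thesis
    using fS by blast
qed

lemma hilbert_space_l2: "hilbert_space (l2_space S)"
proof -
  interpret function_space "l2_functions S"
    by (rule function_space_l2)
  show ?thesis
  proof (intro hilbert_space.intro hilbert_space_axioms.intro)
    show "module complex_ring (l2_space S)"
      unfolding l2_space_def by (rule module)
  next
    fix f g h assume fgh: "f \<in> carrier (l2_space S)" "g \<in> carrier (l2_space S)" "h \<in> carrier (l2_space S)"
    then show "cinner (l2_space S) (f \<oplus>\<^bsub>l2_space S\<^esub> g) h = cinner (l2_space S) f h + cinner (l2_space S) g h"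
      by (simp add: distrib_right infsum_add l2_mult_summable)
  next
    fix f g c
    show "cinner (l2_space S) (c \<odot>\<^bsub>l2_space S\<^esub> f) g = c * cinner (l2_space S) f g"
      by (simp add: mult.assoc infsum_cmult_right')
    show "cinner (l2_space S) f g = cnj (cinner (l2_space S) g f)"
      by (simp flip: infsum_cnj add: mult.commute)
  next
    fix f assume f: "f \<in> carrier (l2_space S)"
    then have self: "cinner (l2_space S) f f = complex_of_real (\<Sum>\<^sub>\<infinity>x. (cmod (f x))\<^sup>2)"
      by (intro l2_cinner_self) simp
    show "0 \<le> Re (cinner (l2_space S) f f)"
      unfolding self by (simp add: infsum_nonneg)
    assume "cinner (l2_space S) f f = 0"
    then have "(\<Sum>\<^sub>\<infinity>x. (cmod (f x))\<^sup>2) \<le> 0"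
      unfolding self by (simp only: of_real_eq_0_iff)
    then have "(cmod (f x))\<^sup>2 = 0" for x
      by (rule nonneg_infsum_le_0D) (use f in \<open>auto simp: l2_functions_def\<close>)
    then show "f = \<zero>\<^bsub>l2_space S\<^esub>"
      by auto
  next
    fix u :: "nat \<Rightarrow> 'a \<Rightarrow> complex"
    assume "range u \<subseteq> carrier (l2_space S)"
      and "\<forall>e>0. \<exists>N. \<forall>m\<ge>N. \<forall>n\<ge>N. hnorm (l2_space S) (u m \<ominus>\<^bsub>l2_space S\<^esub> u n) < e"
    then show "\<exists>f\<in>carrier (l2_space S). (\<lambda>n. hnorm (l2_space S) (u n \<ominus>\<^bsub>l2_space S\<^esub> f)) \<longlonglongrightarrow> 0"
      using l2_complete[of u S] by simp
  qed
qed

text \<open>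
  The inverse makes \<open>p \<mapsto> perm_op S p\<close> a homomorphism instead of an anti-homomorphism.
\<close>

definition perm_op :: "'i set \<Rightarrow> ('i \<Rightarrow> 'i) \<Rightarrow> ('i \<Rightarrow> complex) \<Rightarrow> 'i \<Rightarrow> complex" where
  "perm_op S p = restrict (\<lambda>f. f \<circ> inv_into UNIV p) (l2_functions S)"

lemma l2_comp_perm:
  assumes "p permutes S" "f \<in> l2_functions S"
  shows "f \<circ> p \<in> l2_functions S"
  using assms summable_on_reindex_bij_betw[OF permutes_bij[OF assms(1)], of "\<lambda>x. (cmod (f x))\<^sup>2"]
  by (auto simp: l2_functions_def permutes_not_in)

lemma perm_op_unitary:
  assumes p: "p permutes S"
  shows "perm_op S p \<in> carrier (unitary_group (l2_space S))"
proof -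
  note ip = permutes_inv[OF p]
  have "restrict (\<lambda>f. f \<circ> inv_into UNIV p) (carrier (l2_space S)) \<in> carrier (unitary_group (l2_space S))"
  proof (rule restrict_in_unitary_group[where T' = "\<lambda>f. f \<circ> p"])
    fix f assume "f \<in> carrier (l2_space S)"
    then show "f \<circ> inv_into UNIV p \<in> carrier (l2_space S) \<and> f \<circ> p \<in> carrier (l2_space S) \<and>
        f \<circ> p \<circ> inv_into UNIV p = f \<and> f \<circ> inv_into UNIV p \<circ> p = f"
      using l2_comp_perm[OF p] l2_comp_perm[OF ip]
      by (auto simp: comp_assoc permutes_inv_o[OF p])
  next
    fix f g
    show "cinner (l2_space S) (f \<circ> inv_into UNIV p) (g \<circ> inv_into UNIV p) = cinner (l2_space S) f g"
      using infsum_reindex_bij_betw[OF permutes_bij[OF ip], of "\<lambda>x. f x * cnj (g x)"]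
      by simp
  qed (use function_space.add[OF function_space_l2] function_space.smult[OF function_space_l2]
      in \<open>auto simp: o_def\<close>)
  then show ?thesis
    by (simp add: perm_op_def)
qed

lemma perm_op_mult:
  assumes p: "p permutes S" and q: "q permutes S"
  shows "perm_op S p \<otimes>\<^bsub>unitary_group (l2_space S)\<^esub> perm_op S q = perm_op S (p \<circ> q)"
  unfolding mult_unitary_group[OF perm_op_unitary[OF p] perm_op_unitary[OF q]]
  using l2_comp_perm[OF permutes_inv[OF q]]
  by (auto simp: perm_op_def compose_def fun_eq_iff
      o_inv_distrib[OF permutes_bij[OF p] permutes_bij[OF q]])

lemma perm_op_id: "perm_op S id = \<one>\<^bsub>unitary_group (l2_space S)\<^esub>"
  by (simp add: perm_op_def one_unitary_group fun_eq_iff)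

lemma perm_op_pow:
  assumes p: "p permutes S"
  shows "perm_op S p [^]\<^bsub>unitary_group (l2_space S)\<^esub> (n :: nat) = perm_op S (p ^^ n)"
proof (induction n)
  case (Suc n)
  have "p ^^ n permutes S" for n
    using p by (induction n) (auto intro: permutes_compose)
  then have "perm_op S p [^]\<^bsub>unitary_group (l2_space S)\<^esub> Suc n = perm_op S (p ^^ n \<circ> p)"
    using Suc p by (simp add: perm_op_mult)
  then show ?case
    by (simp only: funpow_Suc_right)
qed (simp add: perm_op_id id_def flip: id_def)

definition rotation :: "'i \<Rightarrow> 'i \<Rightarrow> real \<Rightarrow> real \<Rightarrow> ('i \<Rightarrow> complex) \<Rightarrow> 'i \<Rightarrow> complex" where
  "rotation i j c s f = f(i := c * f i - s * f j, j := s * f i + c * f j)"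

definition rotation_op ::
  "'i set \<Rightarrow> 'i \<Rightarrow> 'i \<Rightarrow> real \<Rightarrow> real \<Rightarrow> ('i \<Rightarrow> complex) \<Rightarrow> 'i \<Rightarrow> complex" where
  "rotation_op S i j c s = restrict (rotation i j c s) (l2_functions S)"

context
  fixes S :: "'i set" and i j :: 'i and c s :: real
  assumes ij: "i \<in> S" "j \<in> S" "i \<noteq> j" and cs: "c\<^sup>2 + s\<^sup>2 = 1"
begin

lemma rotation_coeffs: "complex_of_real c * (c * z) = z - complex_of_real s * (s * z)" for z :: complex
proof -
  have "complex_of_real c * c = 1 - complex_of_real s * s"
    using arg_cong[OF cs, of complex_of_real] by (simp add: power2_eq_square algebra_simps)
  then show ?thesis
    by (simp only: mult.assoc[symmetric]) (simp add: algebra_simps)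
qed

lemma rotation_inverse:
  "rotation i j c s (rotation i j c (- s) f) = f" "rotation i j c (- s) (rotation i j c s f) = f"
  using ij(3) by (auto simp: rotation_def fun_eq_iff algebra_simps rotation_coeffs)

lemma rotation_l2:
  assumes f: "f \<in> l2_functions S"
  shows "rotation i j c s' f \<in> l2_functions S"
proof -
  have "(\<lambda>x. (cmod (f x))\<^sup>2) summable_on - {i, j}"
    using f summable_on_subset_banach[of _ UNIV "- {i, j}"] by (auto simp: l2_functions_def)
  then have "(\<lambda>x. (cmod (rotation i j c s' f x))\<^sup>2) summable_on - {i, j}"
    by (rule summable_on_cong[THEN iffD1, rotated]) (auto simp: rotation_def)
  then have "(\<lambda>x. (cmod (rotation i j c s' f x))\<^sup>2) summable_on (- {i, j} \<union> {i, j})"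
    by (intro summable_on_Un_disjoint) auto
  then show ?thesis
    using f ij by (auto simp: l2_functions_def Un_commute rotation_def)
qed

lemma rotation_cinner:
  assumes f: "f \<in> l2_functions S" and g: "g \<in> l2_functions S"
  shows "(\<Sum>\<^sub>\<infinity>x. rotation i j c s f x * cnj (rotation i j c s g x)) = (\<Sum>\<^sub>\<infinity>x. f x * cnj (g x))"
proof -
  have split: "(\<Sum>\<^sub>\<infinity>x. h x) = (\<Sum>\<^sub>\<infinity>x\<in>- {i, j}. h x) + (h i + h j)"
    if "h summable_on UNIV" for h :: "'i \<Rightarrow> complex"
  proof -
    have "infsum h (- {i, j} \<union> {i, j}) = (\<Sum>\<^sub>\<infinity>x\<in>- {i, j}. h x) + infsum h {i, j}"
      by (intro infsum_Un_disjoint summable_on_subset_banach[OF that]) auto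
    then show ?thesis
      using ij(3) by (simp add: Un_commute)
  qed
  have "(\<Sum>\<^sub>\<infinity>x\<in>- {i, j}. rotation i j c s f x * cnj (rotation i j c s g x)) =
      (\<Sum>\<^sub>\<infinity>x\<in>- {i, j}. f x * cnj (g x))"
    by (rule infsum_cong) (auto simp: rotation_def)
  moreover have "rotation i j c s f i * cnj (rotation i j c s g i) +
      rotation i j c s f j * cnj (rotation i j c s g j) = f i * cnj (g i) + f j * cnj (g j)"
    using ij(3) by (simp add: rotation_def algebra_simps rotation_coeffs)
  ultimately show ?thesis
    using split[OF l2_mult_summable[OF f g]]
      split[OF l2_mult_summable[OF rotation_l2[OF f] rotation_l2[OF g]]] by simp
qed

end

lemma rotation_op_unitary:
  assumes ij: "i \<in> S" "j \<in> S" "i \<noteq> j" and cs: "c\<^sup>2 + s\<^sup>2 = 1"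
  shows "rotation_op S i j c s \<in> carrier (unitary_group (l2_space S))"
proof -
  have "restrict (rotation i j c s) (carrier (l2_space S)) \<in> carrier (unitary_group (l2_space S))"
  proof (rule restrict_in_unitary_group[where T' = "rotation i j c (- s)"])
    fix f assume "f \<in> carrier (l2_space S)"
    then show "rotation i j c s f \<in> carrier (l2_space S) \<and>
        rotation i j c (- s) f \<in> carrier (l2_space S) \<and>
        rotation i j c s (rotation i j c (- s) f) = f \<and>
        rotation i j c (- s) (rotation i j c s f) = f"
      using rotation_l2[OF ij cs] rotation_inverse[OF ij cs] by simp
  next
    fix f g assume "f \<in> carrier (l2_space S)" "g \<in> carrier (l2_space S)"
    then show "cinner (l2_space S) (rotation i j c s f) (rotation i j c s g) = cinner (l2_space S) f g"
      using rotation_cinner[OF ij cs] by simp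
  qed (use function_space.add[OF function_space_l2] function_space.smult[OF function_space_l2]
      in \<open>auto simp: rotation_def fun_eq_iff algebra_simps\<close>)
  then show ?thesis
    by (simp add: rotation_op_def)
qed

text \<open>
  A permutation that fixes \<open>i\<close> and \<open>j\<close> acts trivially on the plane in which the rotation takes
  place and preserves its orthogonal complement.
\<close>

lemma rotation_op_commute:
  assumes ij: "i \<in> S" "j \<in> S" "i \<noteq> j" and cs: "c\<^sup>2 + s\<^sup>2 = 1"
    and p: "p permutes S" "p i = i" "p j = j"
  shows "rotation_op S i j c s \<otimes>\<^bsub>unitary_group (l2_space S)\<^esub> perm_op S p =
    perm_op S p \<otimes>\<^bsub>unitary_group (l2_space S)\<^esub> rotation_op S i j c s"
proof -
  have ip: "inv_into UNIV p x = i \<longleftrightarrow> x = i" "inv_into UNIV p x = j \<longleftrightarrow> x = j" "inv_into UNIV p i = i" "inv_into UNIV p j = j" for x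
    using p by (auto simp: permutes_inv_eq)
  have "rotation i j c s (f \<circ> inv_into UNIV p) = rotation i j c s f \<circ> inv_into UNIV p" for f
    by (auto simp: rotation_def fun_eq_iff ip)
  then show ?thesis
    unfolding mult_unitary_group[OF perm_op_unitary[OF p(1)] rotation_op_unitary[OF ij cs]]
      mult_unitary_group[OF rotation_op_unitary[OF ij cs] perm_op_unitary[OF p(1)]]
    using l2_comp_perm[OF permutes_inv[OF p(1)]] rotation_l2[OF ij cs]
    by (auto simp: perm_op_def rotation_op_def compose_def fun_eq_iff)
qed

section \<open>A relator that kills a generator once another element is killed\<close>

text \<open>
  The relator \<open>a\<^sup>9 (a r a r\<inverse>)\<^sup>-\<^sup>5\<close>.  The exponents are chosen as multiples of the orders 3 and 5 of a
  3-cycle and a 5-cycle such that the exponent sum in \<open>a\<close> is \<open>9 - 2 \<sqdot> 5 = -1\<close>.  The former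
  provides permutations that satisfy the relator, the latter makes it kill \<open>a\<close> when \<open>r = 1\<close>.
\<close>

definition killing_relator :: "('g, 'm) monoid_scheme \<Rightarrow> 'g \<Rightarrow> 'g \<Rightarrow> 'g" where
  "killing_relator M r a = a [^]\<^bsub>M\<^esub> (9 :: nat) \<otimes>\<^bsub>M\<^esub>
     inv\<^bsub>M\<^esub> ((a \<otimes>\<^bsub>M\<^esub> (r \<otimes>\<^bsub>M\<^esub> a \<otimes>\<^bsub>M\<^esub> inv\<^bsub>M\<^esub> r)) [^]\<^bsub>M\<^esub> (5 :: nat))"

context group
begin

lemma killing_relator_closed [simp]:
  "\<lbrakk>r \<in> carrier G; a \<in> carrier G\<rbrakk> \<Longrightarrow> killing_relator G r a \<in> carrier G"
  by (simp add: killing_relator_def)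

lemma killing_relator_one: "r \<in> carrier G \<Longrightarrow> killing_relator G r \<one> = \<one>"
  by (simp add: killing_relator_def)

lemma killing_relator_kills:
  assumes a: "a \<in> carrier G" and rel: "killing_relator G \<one> a = \<one>"
  shows "a = \<one>"
proof -
  have "(a \<otimes> a) [^] (5 :: nat) = a [^] (10 :: nat)"
    using a nat_pow_pow[OF a, of 2 5] by (simp add: numeral_2_eq_2)
  also have "\<dots> = a [^] (9 :: nat) \<otimes> a"
    using nat_pow_Suc[of a 9] by simp
  finally have "a [^] (9 :: nat) \<otimes> inv (a [^] (9 :: nat) \<otimes> a) = \<one>"
    using rel a by (simp add: killing_relator_def)
  then have "a [^] (9 :: nat) \<otimes> a = a [^] (9 :: nat) \<otimes> \<one>"
    using a by (metis inv_closed inv_equality inv_inv m_closed nat_pow_closed r_one)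
  then show ?thesis
    using a l_cancel_one[of "a [^] (9 :: nat)" a] by simp
qed

lemma inv_mult_cancel_left:
  "\<lbrakk>u \<in> carrier G; x \<in> carrier G\<rbrakk> \<Longrightarrow> inv u \<otimes> (u \<otimes> x) = x"
  by (simp flip: m_assoc)

lemma conjugate_pow:
  assumes u: "u \<in> carrier G" and x: "x \<in> carrier G"
  shows "(u \<otimes> x \<otimes> inv u) [^] (n :: nat) = u \<otimes> x [^] n \<otimes> inv u"
proof (induction n)
  case (Suc n)
  have "(u \<otimes> x [^] n \<otimes> inv u) \<otimes> (u \<otimes> x \<otimes> inv u) = u \<otimes> (x [^] n \<otimes> x) \<otimes> inv u"
    using u x by (simp add: m_assoc inv_mult_cancel_left)
  then show ?case
    using Suc u x by simp
qed (use u in simp)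

text \<open>
  A solution \<open>p\<close> of the relator can be deformed by conjugating it with anything that commutes with
  \<open>q\<close>.
\<close>

lemma killing_relator_conjugate:
  assumes p: "p \<in> carrier G" and q: "q \<in> carrier G" and u: "u \<in> carrier G"
    and comm: "u \<otimes> q = q \<otimes> u"
    and p9: "p [^] (9 :: nat) = \<one>" and pq5: "(p \<otimes> (q \<otimes> p \<otimes> inv q)) [^] (5 :: nat) = \<one>"
  shows "killing_relator G q (u \<otimes> p \<otimes> inv u) = \<one>"
proof -
  have "inv u \<otimes> inv q = inv q \<otimes> inv u"
    using u q comm by (metis inv_mult_group)
  moreover have "q \<otimes> (u \<otimes> p \<otimes> inv u) \<otimes> inv q = (q \<otimes> u) \<otimes> p \<otimes> (inv u \<otimes> inv q)"
    using p q u by (simp add: m_assoc)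
  ultimately have "q \<otimes> (u \<otimes> p \<otimes> inv u) \<otimes> inv q = (u \<otimes> q) \<otimes> p \<otimes> (inv q \<otimes> inv u)"
    by (simp only: comm)
  then have "q \<otimes> (u \<otimes> p \<otimes> inv u) \<otimes> inv q = u \<otimes> (q \<otimes> p \<otimes> inv q) \<otimes> inv u"
    using p q u by (simp add: m_assoc)
  then have "(u \<otimes> p \<otimes> inv u) \<otimes> (q \<otimes> (u \<otimes> p \<otimes> inv u) \<otimes> inv q) =
      (u \<otimes> p \<otimes> inv u) \<otimes> (u \<otimes> (q \<otimes> p \<otimes> inv q) \<otimes> inv u)"
    by simp
  also have "\<dots> = u \<otimes> (p \<otimes> (q \<otimes> p \<otimes> inv q)) \<otimes> inv u"
    using p q u by (simp add: m_assoc inv_mult_cancel_left)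
  finally show ?thesis
    using p q u p9 pq5 by (simp add: killing_relator_def conjugate_pow)
qed

end

lemma hom_killing_relator:
  assumes "group G" "group M" "h \<in> hom G M" "r \<in> carrier G" "a \<in> carrier G"
  shows "h (killing_relator G r a) = killing_relator M (h r) (h a)"
proof -
  interpret group_hom G M h
    using assms by (simp add: group_hom_def group_hom_axioms_def)
  show ?thesis
    using assms by (simp add: killing_relator_def hom_nat_pow)
qed

section \<open>A deformation of the trivial representation\<close>

text \<open>
  \<open>Infty\<close> is the point fixed by everything, \<open>Fix k\<close> are points fixed by the group, and
  \<open>Free t k\<close> are copies of the group, on which it acts by left multiplication.
\<close>

datatype 'g point = Infty | Fix nat | Free bool nat 'g

definition points :: "('g, 'm) monoid_scheme \<Rightarrow> 'g point set" where
  "points G = {p. case p of Free t k h \<Rightarrow> h \<in> carrier G | _ \<Rightarrow> True}"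

lemma points_iff [simp]:
  "Infty \<in> points G" "Fix k \<in> points G" "Free t k h \<in> points G \<longleftrightarrow> h \<in> carrier G"
  by (simp_all add: points_def)

definition translate :: "('g, 'm) monoid_scheme \<Rightarrow> 'g \<Rightarrow> 'g point \<Rightarrow> 'g point" where
  "translate G g p =
     (case p of Free t k h \<Rightarrow> if h \<in> carrier G then Free t k (g \<otimes>\<^bsub>G\<^esub> h) else p | _ \<Rightarrow> p)"

lemma translate_simps [simp]:
  "translate G g Infty = Infty"
  "translate G g (Fix k) = Fix k"
  "translate G g (Free t k h) = (if h \<in> carrier G then Free t k (g \<otimes>\<^bsub>G\<^esub> h) else Free t k h)"
  by (simp_all add: translate_def)

text \<open>
  The product over all \<open>k\<close> of the 3-cycles that send \<open>Fix k\<close> to \<open>Free False k e\<close>, this to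
  \<open>Free True (k + j) e\<close>, and this back to \<open>Fix k\<close>.  With \<open>j = 0\<close> they link, for each \<open>k\<close>, the
  three orbits of index \<open>k\<close>;  with \<open>j = 1\<close> they link these to the next index.
\<close>

definition three_cycles :: "nat \<Rightarrow> 'g \<Rightarrow> 'g point \<Rightarrow> 'g point" where
  "three_cycles j e p = (case p of Infty \<Rightarrow> Infty | Fix k \<Rightarrow> Free False k e
     | Free t k h \<Rightarrow> if h \<noteq> e then p else if \<not> t then Free True (k + j) e
         else if j \<le> k then Fix (k - j) else p)"

lemma three_cycles_simps [simp]:
  "three_cycles j e Infty = Infty"
  "three_cycles j e (Fix k) = Free False k e"
  "three_cycles j e (Free False k e) = Free True (k + j) e"
  "three_cycles j e (Free True (k + j) e) = Fix k"
  "k < j \<Longrightarrow> three_cycles j e (Free True k e) = Free True k e"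
  "h \<noteq> e \<Longrightarrow> three_cycles j e (Free t k h) = Free t k h"
  by (simp_all add: three_cycles_def)

lemma point_cases:
  obtains "p = Infty" | k where "p = Fix k" | k h where "p = Free False k h"
    | k h where "p = Free True (k + j) h" | k h where "k < j" "p = Free True k h"
proof (cases p)
  case (Free t k h)
  then show ?thesis
    using that(3)[of k h] that(4)[of "k - j" h] that(5)[of k h] by (cases t; cases "j \<le> k") auto
qed (use that in auto)

lemma three_cycles_pow3: "three_cycles j e ^^ 3 = id"
proof
  fix p :: "'a point"
  show "(three_cycles j e ^^ 3) p = id p"
  proof (cases p rule: point_cases[where j = j])
    case (3 k h) then show ?thesis by (cases "h = e") (simp_all add: numeral_3_eq_3)
  next
    case (4 k h) then show ?thesis by (cases "h = e") (simp_all add: numeral_3_eq_3)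
  next
    case (5 k h) then show ?thesis by (cases "h = e") (simp_all add: numeral_3_eq_3)
  qed (simp_all add: numeral_3_eq_3)
qed

text \<open>
  For each \<open>k\<close> the two 3-cycles share only the point \<open>Fix k\<close>, so their product is the 5-cycle
  \<open>Fix k\<close>, \<open>Free False k e'\<close>, \<open>Free True (k + j) e'\<close>, \<open>Free False k e\<close>, \<open>Free True (k + j) e\<close>.
\<close>

lemma three_cycles_product_pow5:
  assumes e: "e \<noteq> e'"
  shows "(three_cycles j e \<circ> three_cycles j e') ^^ 5 = id"
proof
  fix p :: "'a point"
  note [simp] = e e[symmetric]
  have funpow5: "(f ^^ 5) x = f (f (f (f (f x))))" for f :: "'a point \<Rightarrow> 'a point" and x
    by (simp add: eval_nat_numeral)
  show "((three_cycles j e \<circ> three_cycles j e') ^^ 5) p = id p"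
  proof (cases p rule: point_cases[where j = j])
    case (3 k h) then show ?thesis by (cases "h = e"; cases "h = e'") (simp_all add: funpow5)
  next
    case (4 k h) then show ?thesis by (cases "h = e"; cases "h = e'") (simp_all add: funpow5)
  next
    case (5 k h) then show ?thesis by (cases "h = e"; cases "h = e'") (simp_all add: funpow5)
  qed (simp_all add: funpow5)
qed

lemma bij_imp_permutes_set:
  assumes "bij p" "\<And>x. x \<notin> S \<Longrightarrow> p x = x"
  shows "p permutes S"
  using permutes_superset[OF bij_imp_permutes[of p UNIV], of S] assms by auto

lemma three_cycles_permutes:
  assumes "e \<in> carrier G"
  shows "three_cycles j e permutes points G"
proof (rule bij_imp_permutes_set)
  show "bij (three_cycles j e)"
    using three_cycles_pow3[of j e]
    by (intro o_bij[of "three_cycles j e ^^ 2"]) (auto simp: eval_nat_numeral o_assoc)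
  show "three_cycles j e p = p" if "p \<notin> points G" for p
  proof (cases p)
    case (Free t k h)
    then have "h \<noteq> e"
      using that assms by auto
    then show ?thesis
      using Free by simp
  qed (use that in auto)
qed

context group
begin

lemma translate_mult:
  "\<lbrakk>g \<in> carrier G; k \<in> carrier G\<rbrakk> \<Longrightarrow> translate G (g \<otimes> k) = translate G g \<circ> translate G k"
  by (auto simp: fun_eq_iff translate_def m_assoc split: point.split)

lemma translate_one: "translate G \<one> = id"
  by (auto simp: fun_eq_iff translate_def split: point.split)

lemma translate_permutes:
  assumes g: "g \<in> carrier G"
  shows "translate G g permutes points G"
proof (rule bij_imp_permutes_set)
  show "bij (translate G g)"
    using g by (intro o_bij[of "translate G (inv g)"]) (auto simp flip: translate_mult simp: translate_one)
  show "translate G g p = p" if "p \<notin> points G" for p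
    using that by (cases p) auto
qed

text \<open>
  Conjugation by a group element moves the 3-cycles through the neutral elements of the copies of
  the group to those through \<open>r\<close>.
\<close>

lemma translate_three_cycles:
  assumes r: "r \<in> carrier G"
  shows "translate G r \<circ> three_cycles j \<one> \<circ> translate G (inv r) = three_cycles j r"
proof
  fix p
  have eq: "inv r \<otimes> h = \<one> \<longleftrightarrow> h = r" if "h \<in> carrier G" for h
    using that r by (metis inv_closed inv_equality inv_inv l_inv)
  have c: "r \<otimes> (inv r \<otimes> h) = h" if "h \<in> carrier G" for h
    using that r by (simp flip: m_assoc)
  show "(translate G r \<circ> three_cycles j \<one> \<circ> translate G (inv r)) p = three_cycles j r p"
    using r by (auto simp: translate_def three_cycles_def eq c split: point.splits)
qed

lemma translate_op_hom:
  "(\<lambda>g. perm_op (points G) (translate G g)) \<in> hom G (unitary_group (l2_space (points G)))"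
  by (intro homI) (simp_all add: perm_op_unitary perm_op_mult translate_permutes translate_mult)

end

lemma perm_op_fixed:
  assumes p: "p permutes S" and f: "f \<in> l2_functions S" and "perm_op S p f = f"
  shows "f (p x) = f x"
proof -
  have "f \<circ> inv_into UNIV p = f"
    using assms by (simp add: perm_op_def)
  from fun_cong[OF this, of "p x"] show ?thesis
    using permutes_inverses(2)[OF p] by simp
qed

lemma l2_constant_zero:
  fixes e :: "nat \<Rightarrow> 'i"
  assumes f: "f \<in> l2_functions S" and e: "inj e" and const: "\<And>k. f (e k) = w"
  shows "w = 0"
proof (rule ccontr)
  assume "w \<noteq> 0"
  then obtain n where n: "(hnorm (l2_space S) f)\<^sup>2 < of_nat n * (cmod w)\<^sup>2"
    using ex_less_of_nat_mult[of "(cmod w)\<^sup>2" "(hnorm (l2_space S) f)\<^sup>2"] by auto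
  have "(\<Sum>x\<in>e ` {..<n}. (cmod (f x))\<^sup>2) = of_nat n * (cmod w)\<^sup>2"
    using e by (simp add: sum.reindex inj_on_subset const)
  then show False
    using n l2_finite_sum_le[OF f, of "e ` {..<n}"] by simp
qed

text \<open>
  The permutations \<open>a\<close> and \<open>b\<close> satisfy the relators.  The operator \<open>B\<close> is that of \<open>b\<close>, while \<open>A\<close>
  is that of \<open>a\<close> conjugated by a rotation \<open>V\<close> in the plane of \<open>\<delta>\<^sub>\<infinity>\<close> and \<open>\<delta>\<^sub>y\<close>, where
  \<open>y = Fix 0\<close>.  A vector \<open>v\<close> fixed by the group and by \<open>B\<close> takes one value \<open>w k\<close> on all points of
  index \<open>k\<close>.  That \<open>V\<inverse> v\<close> is fixed by \<open>a\<close> gives \<open>w (k + 1) = w k\<close> from the points of the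
  copies of the group, which \<open>V\<close> does not touch, so \<open>w = 0\<close> by summability.  It also
  gives \<open>(V\<inverse> v) y = 0\<close>, where the left side is a non-zero multiple of \<open>v \<infinity>\<close> because \<open>v y = 0\<close>.
\<close>

lemma unitary_deformation:
  fixes G :: "('g, 'm) monoid_scheme"
  assumes G: "group G" and r: "r \<in> carrier G" "r \<noteq> \<one>\<^bsub>G\<^esub>" and \<delta>: "\<delta> > 0"
  obtains H :: "('g point \<Rightarrow> complex) hilbert" and \<sigma> A B \<xi>
  where "hilbert_space H" and "\<sigma> \<in> hom G (unitary_group H)"
    and "A \<in> carrier (unitary_group H)" and "B \<in> carrier (unitary_group H)"
    and "killing_relator (unitary_group H) (\<sigma> r) A = \<one>\<^bsub>unitary_group H\<^esub>"
    and "killing_relator (unitary_group H) (\<sigma> r) B = \<one>\<^bsub>unitary_group H\<^esub>"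
    and "\<xi> \<in> carrier H" and "\<xi> \<noteq> \<zero>\<^bsub>H\<^esub>"
    and "\<And>g. g \<in> carrier G \<Longrightarrow> \<sigma> g \<xi> = \<xi>" and "B \<xi> = \<xi>"
    and "hnorm H (A \<xi> \<ominus>\<^bsub>H\<^esub> \<xi>) \<le> \<delta> * hnorm H \<xi>"
    and "\<And>v. \<lbrakk>v \<in> carrier H; \<And>g. g \<in> carrier G \<Longrightarrow> \<sigma> g v = v; A v = v; B v = v\<rbrakk> \<Longrightarrow> v = \<zero>\<^bsub>H\<^esub>"
proof -
  interpret G: group G
    by (rule G)
  define S where "S = points G"
  define H where "H = l2_space S"
  have S_simps [simp]: "Infty \<in> S" "Fix k \<in> S" "Free t k h \<in> S \<longleftrightarrow> h \<in> carrier G" for t k h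
    by (simp_all add: S_def)
  interpret H: hilbert_space H
    unfolding H_def by (rule hilbert_space_l2)
  interpret U: group "unitary_group H"
    by (rule H.group_unitary_group)
  \<comment> \<open>The sine of the angle of rotation:  \<open>\<delta>\<^sub>\<infinity>\<close> is moved by \<open>\<surd>2 s\<close>, which is at most \<open>2 s\<close>.\<close>
  define s where "s = min 1 (\<delta> / 2)"
  have s: "s > 0" "s \<le> 1" "2 * s \<le> \<delta>"
    using \<delta> by (auto simp: s_def)
  define c where "c = sqrt (1 - s\<^sup>2)"
  have cs: "c\<^sup>2 + s\<^sup>2 = 1" "c\<^sup>2 + (- s)\<^sup>2 = 1"
    using s by (simp_all add: c_def power_le_one)
  have ij: "Infty \<in> S" "Fix 0 \<in> S" "Infty \<noteq> Fix 0"
    by auto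
  define \<sigma> where "\<sigma> g = perm_op S (translate G g)" for g
  define a b :: "'g point \<Rightarrow> 'g point" where "a = three_cycles 1 \<one>\<^bsub>G\<^esub>" and "b = three_cycles 0 \<one>\<^bsub>G\<^esub>"
  define V where "V = rotation_op S Infty (Fix 0) c s"
  define A where "A = V \<otimes>\<^bsub>unitary_group H\<^esub> perm_op S a \<otimes>\<^bsub>unitary_group H\<^esub> inv\<^bsub>unitary_group H\<^esub> V"
  define B where "B = perm_op S b"
  define \<xi> where "\<xi> p = (if p = Infty then 1 else 0 :: complex)" for p :: "'g point"
  have \<sigma>_hom: "\<sigma> \<in> hom G (unitary_group H)"
    unfolding \<sigma>_def H_def S_def by (rule G.translate_op_hom)
  interpret \<sigma>: group_hom G "unitary_group H" \<sigma>
    using \<sigma>_hom by unfold_locales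
  have perm: "three_cycles j \<one>\<^bsub>G\<^esub> permutes S" for j
    unfolding S_def by (rule three_cycles_permutes) simp
  have ab: "a permutes S" "b permutes S"
    by (simp_all add: a_def b_def perm)
  have transl: "translate G g permutes S" if "g \<in> carrier G" for g
    unfolding S_def using that by (rule G.translate_permutes)
  have V: "V \<in> carrier (unitary_group H)"
    unfolding V_def H_def using ij cs(1) by (rule rotation_op_unitary)
  have P: "perm_op S p \<in> carrier (unitary_group H)" if "p permutes S" for p
    unfolding H_def using that by (rule perm_op_unitary)
  have A: "A \<in> carrier (unitary_group H)" and B: "B \<in> carrier (unitary_group H)"
    using V P ab by (auto simp: A_def B_def)

  have pow9: "perm_op S (three_cycles j \<one>\<^bsub>G\<^esub>) [^]\<^bsub>unitary_group H\<^esub> (9 :: nat) = \<one>\<^bsub>unitary_group H\<^esub>" for j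
  proof -
    have "three_cycles j \<one>\<^bsub>G\<^esub> ^^ 9 = id"
    proof -
      have "three_cycles j \<one>\<^bsub>G\<^esub> ^^ (3 * 3) = id"
        by (simp only: flip: funpow_mult) (simp add: three_cycles_pow3)
      then show ?thesis
        by simp
    qed
    then show ?thesis
      using perm_op_pow[OF perm, of j 9] by (simp add: H_def perm_op_id)
  qed
  have pow5: "(perm_op S (three_cycles j \<one>\<^bsub>G\<^esub>) \<otimes>\<^bsub>unitary_group H\<^esub>
      (\<sigma> r \<otimes>\<^bsub>unitary_group H\<^esub> perm_op S (three_cycles j \<one>\<^bsub>G\<^esub>) \<otimes>\<^bsub>unitary_group H\<^esub>
        inv\<^bsub>unitary_group H\<^esub> \<sigma> r)) [^]\<^bsub>unitary_group H\<^esub> (5 :: nat) = \<one>\<^bsub>unitary_group H\<^esub>" for j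
  proof -
    have "inv\<^bsub>unitary_group H\<^esub> \<sigma> r = perm_op S (translate G (inv\<^bsub>G\<^esub> r))"
      using \<sigma>.hom_inv[OF r(1)] by (simp add: \<sigma>_def)
    then have "\<sigma> r \<otimes>\<^bsub>unitary_group H\<^esub> perm_op S (three_cycles j \<one>\<^bsub>G\<^esub>) \<otimes>\<^bsub>unitary_group H\<^esub>
        inv\<^bsub>unitary_group H\<^esub> \<sigma> r = perm_op S (three_cycles j r)"
      using r(1) perm transl
      by (simp add: \<sigma>_def H_def perm_op_mult permutes_compose G.translate_three_cycles)
    moreover have "three_cycles j r permutes S"
      unfolding S_def using r(1) by (rule three_cycles_permutes)
    ultimately show ?thesis
      using perm r(2) three_cycles_product_pow5[of "\<one>\<^bsub>G\<^esub>" r j]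
      by (simp add: H_def perm_op_mult perm_op_pow permutes_compose perm_op_id)
  qed
  have "V \<otimes>\<^bsub>unitary_group H\<^esub> \<sigma> r = \<sigma> r \<otimes>\<^bsub>unitary_group H\<^esub> V"
    unfolding V_def \<sigma>_def H_def by (rule rotation_op_commute[OF ij cs(1) transl[OF r(1)]]) auto
  then have rel_A: "killing_relator (unitary_group H) (\<sigma> r) A = \<one>\<^bsub>unitary_group H\<^esub>"
    unfolding A_def a_def
    by (intro U.killing_relator_conjugate pow9 pow5 P perm V \<sigma>.hom_closed r(1))
  have rel_B: "killing_relator (unitary_group H) (\<sigma> r) B = \<one>\<^bsub>unitary_group H\<^esub>"
    using pow9[of 0] pow5[of 0] by (simp add: B_def b_def killing_relator_def)

  have l2_\<xi>: "\<xi> \<in> l2_functions S"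
  proof -
    have "(\<lambda>p. (cmod (\<xi> p))\<^sup>2) summable_on UNIV"
      using summable_on_cong_neutral[of UNIV "{Infty}" "\<lambda>p. (cmod (\<xi> p))\<^sup>2" "\<lambda>p. (cmod (\<xi> p))\<^sup>2"]
      by (simp add: \<xi>_def)
    then show ?thesis
      by (auto simp: l2_functions_def \<xi>_def)
  qed
  have norm_\<xi>: "hnorm H \<xi> = 1"
  proof -
    have "(\<Sum>\<^sub>\<infinity>p. (cmod (\<xi> p))\<^sup>2) = (\<Sum>\<^sub>\<infinity>p\<in>{Infty}. (cmod (\<xi> p))\<^sup>2)"
      by (rule infsum_cong_neutral) (auto simp: \<xi>_def)
    then show ?thesis
      using l2_\<xi> by (simp add: H_def l2_hnorm \<xi>_def)
  qed
  have inv_V: "(inv\<^bsub>unitary_group H\<^esub> V) f = rotation Infty (Fix 0) c (- s) f" if f: "f \<in> l2_functions S" for f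
  proof -
    have l2: "rotation Infty (Fix 0) c (- s) f \<in> l2_functions S"
      by (rule rotation_l2[OF ij cs(1) f])
    then have "V (rotation Infty (Fix 0) c (- s) f) = f"
      using rotation_inverse(1)[OF ij cs(1)] by (simp add: V_def rotation_op_def)
    then show ?thesis
      using H.inv_unitary_group(1)[OF V, of "rotation Infty (Fix 0) c (- s) f"] l2
      by (simp add: H_def)
  qed
  have A_apply: "A f = V (perm_op S a (rotation Infty (Fix 0) c (- s) f))"
    and rot_carrier: "rotation Infty (Fix 0) c (- s) f \<in> carrier H"
    and perm_carrier: "perm_op S a (rotation Infty (Fix 0) c (- s) f) \<in> carrier H"
    if f: "f \<in> l2_functions S" for f
  proof -
    have fc: "f \<in> carrier H"
      using f by (simp add: H_def)
    show rc: "rotation Infty (Fix 0) c (- s) f \<in> carrier H"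
      using rotation_l2[OF ij cs(1) f] by (simp add: H_def)
    then show "perm_op S a (rotation Infty (Fix 0) c (- s) f) \<in> carrier H"
      by (rule unitary_group_closed[OF P[OF ab(1)]])
    show "A f = V (perm_op S a (rotation Infty (Fix 0) c (- s) f))"
      using mult_unitary_group[OF U.m_closed[OF V P[OF ab(1)]] U.inv_closed[OF V]]
        mult_unitary_group[OF V P[OF ab(1)]] fc rc
      by (simp add: A_def compose_eq inv_V[OF f])
  qed
  have fix_\<xi>: "perm_op S p \<xi> = \<xi>" if p: "p permutes S" "p Infty = Infty" for p
  proof -
    have "inv_into UNIV p x = Infty \<longleftrightarrow> x = Infty" for x
      using p by (auto simp: permutes_inv_eq)
    then show ?thesis
      using l2_\<xi> by (auto simp: perm_op_def \<xi>_def fun_eq_iff)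
  qed
  have small: "hnorm H (A \<xi> \<ominus>\<^bsub>H\<^esub> \<xi>) \<le> \<delta>"
  proof -
    define g where "g = rotation Infty (Fix 0) c (- s) \<xi>"
    define D where "D = (\<lambda>p. perm_op S a g p - g p)"
    have g: "g \<in> carrier H" "g \<in> l2_functions S" "perm_op S a g \<in> carrier H"
        "perm_op S a g \<in> l2_functions S"
      using rot_carrier[OF l2_\<xi>] perm_carrier[OF l2_\<xi>] by (auto simp: g_def H_def)
    \<comment> \<open>Since \<open>V\<close> is an isometry, the displacement of \<open>\<xi>\<close> by \<open>A\<close> is that of \<open>V\<inverse> \<xi>\<close> by the permutation.\<close>
    have "V g = \<xi>"
      using rotation_inverse(1)[OF ij cs(1)] g by (simp add: V_def rotation_op_def g_def)
    then have "hnorm H (A \<xi> \<ominus>\<^bsub>H\<^esub> \<xi>) = hnorm H (perm_op S a g \<ominus>\<^bsub>H\<^esub> g)"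
      using H.hnorm_unitary_diff[OF V g(3,1)] A_apply[OF l2_\<xi>] by (simp add: g_def)
    also have "perm_op S a g \<ominus>\<^bsub>H\<^esub> g = D"
      using g by (simp add: H_def l2_minus D_def)
    also have "hnorm H D \<le> \<delta>"
    proof -
      have inv_a: "inv_into UNIV a p = Infty \<longleftrightarrow> p = Infty"
          "inv_into UNIV a p = Fix 0 \<longleftrightarrow> p = Free False 0 \<one>\<^bsub>G\<^esub>" for p
        using permutes_inv_eq[OF ab(1), of p] by (auto simp: a_def)
      have g_eq: "g p = (if p = Infty then c else if p = Fix 0 then - s else 0)" for p
        by (simp add: g_def rotation_def \<xi>_def)
      have Pg: "perm_op S a g p =
          (if p = Infty then c else if p = Free False 0 \<one>\<^bsub>G\<^esub> then - s else 0)" for p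
        using g(2) by (simp add: perm_op_def g_eq inv_a)
      have D_eq: "D p = (if p = Fix 0 then s else if p = Free False 0 \<one>\<^bsub>G\<^esub> then - s else 0)" for p
        by (simp add: D_def Pg g_eq)
      have "D \<in> l2_functions S"
        using function_space.diff[OF function_space_l2 g(4,2)] by (simp add: D_def)
      moreover have "(\<Sum>\<^sub>\<infinity>p. (cmod (D p))\<^sup>2) =
          (\<Sum>\<^sub>\<infinity>p\<in>{Fix 0, Free False 0 \<one>\<^bsub>G\<^esub>}. (cmod (D p))\<^sup>2)"
        by (rule infsum_cong_neutral) (auto simp: D_eq)
      then have "(\<Sum>\<^sub>\<infinity>p. (cmod (D p))\<^sup>2) = s\<^sup>2 + s\<^sup>2"
        by (simp add: D_eq)
      ultimately have "hnorm H D = sqrt (s\<^sup>2 + s\<^sup>2)"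
        by (simp add: H_def l2_hnorm)
      also have "\<dots> \<le> s + s"
        using s sqrt_sum_squares_le_sum[of s s] by simp
      finally show ?thesis
        using s by simp
    qed
    finally show ?thesis .
  qed
  have no_fixed: "v = \<zero>\<^bsub>H\<^esub>"
    if v: "v \<in> carrier H" and \<sigma>v: "\<And>g. g \<in> carrier G \<Longrightarrow> \<sigma> g v = v" and Av: "A v = v" and Bv: "B v = v"
    for v
  proof -
    have l2: "v \<in> l2_functions S"
      using v by (simp add: H_def)
    have orbit: "v (Free t k h) = v (Free t k \<one>\<^bsub>G\<^esub>)" if "h \<in> carrier G" for t k h
      using perm_op_fixed[OF transl[OF that] l2, of "Free t k \<one>\<^bsub>G\<^esub>"] \<sigma>v[OF that] that
      by (simp add: \<sigma>_def)
    have bv: "v (b p) = v p" for p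
      using perm_op_fixed[OF ab(2) l2] Bv by (simp add: B_def)
    have b_cycle: "v (Free False k \<one>\<^bsub>G\<^esub>) = v (Fix k)" "v (Free True k \<one>\<^bsub>G\<^esub>) = v (Fix k)" for k
      using bv[of "Fix k"] bv[of "Free False k \<one>\<^bsub>G\<^esub>"] by (simp_all add: b_def)
    define g where "g = rotation Infty (Fix 0) c (- s) v"
    have g: "g \<in> l2_functions S"
      using rot_carrier[OF l2] by (simp add: g_def H_def)
    have "V (perm_op S a g) = V g"
      using A_apply[OF l2] Av rotation_inverse(1)[OF ij cs(1)] g
      by (simp add: g_def V_def rotation_op_def)
    then have "perm_op S a g = g"
      using H.inv_unitary_group(1)[OF V] perm_carrier[OF l2] rot_carrier[OF l2]
      by (metis g_def)
    then have ag: "g (a p) = g p" for p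
      using perm_op_fixed[OF ab(1) g] by simp
    have g_Free: "g (Free t k h) = v (Free t k h)" for t k h
      by (simp add: g_def rotation_def)
    \<comment> \<open>The permutation \<open>a\<close> takes \<open>Free False k 1\<close> to \<open>Free True (k + 1) 1\<close>.\<close>
    have "v (Fix (Suc k)) = v (Fix k)" for k
      using ag[of "Free False k \<one>\<^bsub>G\<^esub>"] by (simp add: a_def g_Free b_cycle)
    then have const: "v (Fix k) = v (Fix 0)" for k
      by (induction k) auto
    have Fix: "v (Fix k) = 0" for k
      using l2_constant_zero[OF l2, of Fix "v (Fix 0)"] const by (simp add: inj_def)
    have "g (Fix 0) = 0"
      using ag[of "Fix 0"] by (simp add: a_def g_Free b_cycle Fix)
    then have "v Infty = 0"
      using s Fix[of 0] by (simp add: g_def rotation_def)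
    moreover have "v (Free t k h) = 0" for t k h
    proof (cases "h \<in> carrier G")
      case True
      then show ?thesis
        using orbit[OF True] b_cycle Fix by (cases t) auto
    next
      case False
      then show ?thesis
        using l2 by (simp add: l2_functions_def)
    qed
    ultimately have "v p = 0" for p
      using Fix by (cases p) auto
    then show ?thesis
      by (auto simp: H_def)
  qed
  show thesis
  proof (rule that[OF H.hilbert_space_axioms \<sigma>_hom A B rel_A rel_B])
    show "\<xi> \<in> carrier H"
      using l2_\<xi> by (simp add: H_def)
    show "\<xi> \<noteq> \<zero>\<^bsub>H\<^esub>"
      using norm_\<xi> by auto
    show "\<sigma> g \<xi> = \<xi>" if "g \<in> carrier G" for g
      unfolding \<sigma>_def using fix_\<xi>[OF transl[OF that]] by simp
    show "B \<xi> = \<xi>"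
      unfolding B_def using fix_\<xi>[OF ab(2)] by (simp add: b_def)
    show "hnorm H (A \<xi> \<ominus>\<^bsub>H\<^esub> \<xi>) \<le> \<delta> * hnorm H \<xi>"
      using small norm_\<xi> by simp
  qed (rule no_fixed)
qed

section \<open>Just-(T) presentations\<close>

lemma free_group_inclusion_hom: "X \<subseteq> Y \<Longrightarrow> (\<lambda>w. w) \<in> hom (free_group X) (free_group Y)"
  using free_group_mono[of X Y] by (auto simp: hom_def mult_free_group)

lemma presented_group_cong:
  "normal_closure (free_group X) R = normal_closure (free_group X) R' \<Longrightarrow>
    presented_group X R = presented_group X R'"
  by (simp add: presented_group_def)

lemma normal_closure_redundant:
  assumes R: "R \<subseteq> carrier (free_group X)" and "R' \<subseteq> R"
    and "R \<subseteq> normal_closure (free_group X) R'"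
  shows "normal_closure (free_group X) R = normal_closure (free_group X) R'"
proof
  have "normal_closure (free_group X) R' \<lhd> free_group X"
    using assms by (intro normal_normal_closure group_free_group) auto
  with assms(3) show "normal_closure (free_group X) R \<subseteq> normal_closure (free_group X) R'"
    unfolding normal_closure_def by (intro hull_minimal)
  show "normal_closure (free_group X) R' \<subseteq> normal_closure (free_group X) R"
    unfolding normal_closure_def by (rule hull_mono[OF assms(2)])
qed

text \<open>
  A subset of least cardinality with the same normal closure.
\<close>

lemma irredundant_relators:
  assumes "finite R" and R: "R \<subseteq> carrier (free_group X)"
  obtains R' where "R' \<subseteq> R" "presented_group X R' = presented_group X R"
    "\<And>r. r \<in> R' \<Longrightarrow> r \<notin> normal_closure (free_group X) (R' - {r})"
proof -
  let ?nc = "normal_closure (free_group X)"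
  obtain R' where R': "R' \<subseteq> R" "?nc R' = ?nc R"
    and minimal: "\<And>R''. \<lbrakk>R'' \<subseteq> R; ?nc R'' = ?nc R\<rbrakk> \<Longrightarrow> card R' \<le> card R''"
    using ex_has_least_nat[of "\<lambda>R'. R' \<subseteq> R \<and> ?nc R' = ?nc R" R card] by auto
  have "r \<notin> ?nc (R' - {r})" if r: "r \<in> R'" for r
  proof
    assume "r \<in> ?nc (R' - {r})"
    moreover have "R' - {r} \<subseteq> ?nc (R' - {r})"
      unfolding normal_closure_def by (rule hull_subset)
    ultimately have "?nc R' = ?nc (R' - {r})"
      using R' R by (intro normal_closure_redundant) auto
    then have "card R' \<le> card (R' - {r})"
      using R' by (intro minimal) auto
    then show False
      using r R'(1) \<open>finite R\<close> by (metis card_Diff1_less finite_subset not_le)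
  qed
  then show thesis
    using that R' presented_group_cong by metis
qed

text \<open>
  The presentation obtained from \<open>\<langle>X | R\<rangle>\<close> by adding, for each \<open>r \<in> R\<close>, the two generators
  \<open>new (r, False)\<close> and \<open>new (r, True)\<close> with their killing relators.  Two are needed
  because one has to link the orbits of the points while the operator of the other is deformed.
\<close>

locale killed_generators =
  fixes X :: "'x set" and R :: "'x word set" and new :: "'x word \<times> bool \<Rightarrow> 'x"
  assumes relators: "R \<subseteq> carrier (free_group X)"
    and new_inj: "inj_on new (R \<times> UNIV)"
    and new_notin: "\<And>i. i \<in> R \<times> UNIV \<Longrightarrow> new i \<notin> X"
begin

definition generators :: "'x set" where
  "generators = X \<union> new ` (R \<times> UNIV)"

definition killer :: "'x word \<times> bool \<Rightarrow> 'x word" where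
  "killer i = killing_relator (free_group generators) (fst i) [(new i, True)]"

definition relations :: "'x word set" where
  "relations = R \<union> killer ` (R \<times> UNIV)"

lemma X_subset: "X \<subseteq> generators"
  by (simp add: generators_def)

lemma relators_in_generators: "r \<in> R \<Longrightarrow> r \<in> carrier (free_group generators)"
  using relators free_group_mono[OF X_subset] by blast

lemma new_generator: "i \<in> R \<times> UNIV \<Longrightarrow> [(new i, True)] \<in> carrier (free_group generators)"
  by (simp add: generators_def)

lemma relations_subset: "relations \<subseteq> carrier (free_group generators)"
  using relators_in_generators new_generator group.killing_relator_closed[OF group_free_group]
  by (fastforce simp: relations_def killer_def)

lemma hom_killer:
  assumes M: "group M" and f: "f \<in> generators \<rightarrow> carrier M" and i: "i \<in> R \<times> UNIV"
  shows "word_value M f (killer i) = killing_relator M (word_value M f (fst i)) (f (new i))"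
proof -
  have "new i \<in> generators"
    using i by (simp add: generators_def)
  then have "f (new i) \<in> carrier M"
    using f by blast
  moreover have "fst i \<in> R"
    using i by auto
  ultimately show ?thesis
    using hom_killing_relator[OF group_free_group M group.word_value_hom[OF M f] relators_in_generators new_generator[OF i]]
      group.word_value_generator[OF M, of f "new i"]
    by (simp add: killer_def del: word_value_simps)
qed

text \<open>
  The two homomorphisms are the identity on \<open>X\<close>, and one of them sends the new generators to \<open>1\<close>.
  They are inverse to each other because the killing relators already make the new generators trivial.
\<close>

lemma presented_group_iso: "presented_group generators relations \<cong> presented_group X R"
proof -
  let ?P = "presented_group X R" and ?P' = "presented_group generators relations"
  let ?c = "presented_class X R" and ?c' = "presented_class generators relations"
  interpret P: group ?P
    by (rule group_presented_group[OF relators])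
  interpret P': group ?P'
    by (rule group_presented_group[OF relations_subset])
  have c: "?c \<in> hom (free_group X) ?P"
    by (rule presented_class_hom[OF relators])
  have c': "?c' \<in> hom (free_group generators) ?P'"
    by (rule presented_class_hom[OF relations_subset])
  define f where "f x = (if x \<in> X then ?c [(x, True)] else \<one>\<^bsub>?P\<^esub>)" for x
  have f: "f \<in> generators \<rightarrow> carrier ?P"
    using hom_in_carrier[OF c] by (auto simp: f_def)
  have f_word: "word_value ?P f w = ?c w" if w: "w \<in> carrier (free_group X)" for w
    using P.hom_free_group_eq[OF c w] P.word_value_cong[of X f "\<lambda>x. ?c [(x, True)]" w] w
    by (simp add: f_def carrier_free_group)
  have "word_value ?P f q = \<one>\<^bsub>?P\<^esub>" if "q \<in> relations" for q
    using that unfolding relations_def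
  proof
    assume "q \<in> R"
    then show ?thesis
      using f_word relators presented_class_relator[OF relators] by auto
  next
    assume "q \<in> killer ` (R \<times> UNIV)"
    then obtain i where i: "i \<in> R \<times> UNIV" "q = killer i"
      by blast
    then have "word_value ?P f (fst i) = \<one>\<^bsub>?P\<^esub>"
      using f_word relators presented_class_relator[OF relators] by auto
    moreover have "f (new i) = \<one>\<^bsub>?P\<^esub>"
      using new_notin[OF i(1)] by (simp add: f_def)
    ultimately show ?thesis
      using hom_killer[OF P.group_axioms f i(1)] i(2) P.killing_relator_one[OF P.one_closed] by simp
  qed
  then obtain \<phi> where \<phi>: "\<phi> \<in> hom ?P' ?P"
    and \<phi>_class: "\<And>w. w \<in> carrier (free_group generators) \<Longrightarrow> \<phi> (?c' w) = word_value ?P f w"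
    using presented_group_universal[OF relations_subset P.group_axioms P.word_value_hom[OF f]] by blast
  have "?c' \<circ> (\<lambda>w. w) \<in> hom (free_group X) ?P'"
    by (rule Group.hom_compose[OF free_group_inclusion_hom[OF X_subset] c'])
  then have incl: "?c' \<in> hom (free_group X) ?P'"
    by (simp add: o_def)
  have relator_one: "?c' r = \<one>\<^bsub>?P'\<^esub>" if "r \<in> R" for r
    using that by (intro presented_class_relator[OF relations_subset]) (simp add: relations_def)
  obtain \<psi> where \<psi>: "\<psi> \<in> hom ?P ?P'"
    and \<psi>_class: "\<And>w. w \<in> carrier (free_group X) \<Longrightarrow> \<psi> (?c w) = ?c' w"
    using presented_group_universal[OF relators P'.group_axioms incl] relator_one by blast
  have new_one: "?c' [(new i, True)] = \<one>\<^bsub>?P'\<^esub>" if i: "i \<in> R \<times> UNIV" for i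
  proof (rule P'.killing_relator_kills)
    show "?c' [(new i, True)] \<in> carrier ?P'"
      using hom_in_carrier[OF c' new_generator[OF i]] .
    have "fst i \<in> R"
      using i by auto
    then have "?c' (killer i) = killing_relator ?P' \<one>\<^bsub>?P'\<^esub> (?c' [(new i, True)])"
      using hom_killing_relator[OF group_free_group P'.group_axioms c' relators_in_generators new_generator[OF i]]
      by (simp add: killer_def relator_one)
    moreover have "?c' (killer i) = \<one>\<^bsub>?P'\<^esub>"
      using i by (intro presented_class_relator[OF relations_subset]) (simp add: relations_def)
    ultimately show "killing_relator ?P' \<one>\<^bsub>?P'\<^esub> (?c' [(new i, True)]) = \<one>\<^bsub>?P'\<^esub>"
      by simp
  qed
  have \<phi>\<psi>: "\<phi> (\<psi> p) = p" if p: "p \<in> carrier ?P" for p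
  proof -
    obtain w where w: "w \<in> carrier (free_group X)" "p = ?c w"
      using p unfolding carrier_presented_group[OF relators] by blast
    moreover have "w \<in> carrier (free_group generators)"
      using w free_group_mono[OF X_subset] by blast
    ultimately show ?thesis
      by (simp add: \<psi>_class \<phi>_class f_word)
  qed
  have \<psi>\<phi>: "\<psi> (\<phi> p) = p" if p: "p \<in> carrier ?P'" for p
  proof -
    obtain w where w: "w \<in> carrier (free_group generators)" "p = ?c' w"
      using p unfolding carrier_presented_group[OF relations_subset] by blast
    let ?h = "\<psi> \<circ> (\<phi> \<circ> ?c')"
    have h: "?h \<in> hom (free_group generators) ?P'"
      by (intro Group.hom_compose[OF _ \<psi>] Group.hom_compose[OF c' \<phi>])
    have "?h [(x, True)] = ?c' [(x, True)]" if x: "x \<in> generators" for x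
    proof -
      have fx: "\<phi> (?c' [(x, True)]) = f x"
        using x f P.word_value_generator[of f x] by (subst \<phi>_class) auto
      show ?thesis
      proof (cases "x \<in> X")
        case True
        then show ?thesis
          using fx \<psi>_class[of "[(x, True)]"] by (simp add: f_def)
      next
        case False
        then obtain i where "i \<in> R \<times> UNIV" "x = new i"
          using x by (auto simp: generators_def)
        moreover have "\<psi> \<one>\<^bsub>?P\<^esub> = \<one>\<^bsub>?P'\<^esub>"
          by (rule hom_one[OF \<psi> P.group_axioms P'.group_axioms])
        ultimately show ?thesis
          using fx False new_one by (simp add: f_def)
      qed
    qed
    then have "?h w = ?c' w"
      using P'.hom_free_group_eq[OF h w(1)] P'.hom_free_group_eq[OF c' w(1)] w(1)
        P'.word_value_cong[of generators "\<lambda>x. ?h [(x, True)]" "\<lambda>x. ?c' [(x, True)]" w]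
      by (simp add: carrier_free_group)
    then show ?thesis
      using w by simp
  qed
  have "bij_betw \<phi> (carrier ?P') (carrier ?P)"
    using \<phi>\<psi> \<psi>\<phi> hom_in_carrier[OF \<phi>] hom_in_carrier[OF \<psi>]
    by (intro bij_betw_byWitness[where f' = \<psi>]) auto
  then show ?thesis
    using \<phi> by (auto simp: is_iso_def iso_def)
qed

text \<open>
  The generator \<open>new i\<close> occurs in no other relator, so it can be sent to any scalar \<open>z\<close> of modulus
  \<open>1\<close> and all other generators to \<open>1\<close>.  The type \<^typ>\<open>unit\<close> serves as a one-point index set
  for a one-dimensional Hilbert space.
\<close>

lemma not_property_T_without_killer:
  assumes i: "i \<in> R \<times> UNIV"
  shows "\<not> property_T (presented_group generators (relations - {killer i}))"
proof (rule not_property_T_presented_group)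
  show "relations - {killer i} \<subseteq> carrier (free_group generators)"
    using relations_subset by blast
  fix \<delta> :: real assume "\<delta> > 0"
  define H where "H = l2_space (UNIV :: unit set)"
  interpret hilbert_space H
    unfolding H_def by (rule hilbert_space_l2)
  interpret U: group "unitary_group H"
    by (rule group_unitary_group)
  have carrier_H: "v \<in> carrier H" for v
    by (simp add: H_def l2_functions_def)
  obtain z where z: "cmod z = 1" "z \<noteq> 1" "cmod (z - 1) \<le> \<delta>"
  proof -
    have "(cis \<longlongrightarrow> cis 0) (at_right 0)"
      by (intro tendsto_intros)
    then have "\<forall>\<^sub>F \<theta> in at_right 0. dist (cis \<theta>) (cis 0) < \<delta>"
      using \<open>\<delta> > 0\<close> by (rule tendstoD)
    moreover have "\<forall>\<^sub>F \<theta> :: real in at_right 0. \<theta> \<in> {0<..<1}"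
      by (rule eventually_at_right_real) simp
    ultimately have "\<forall>\<^sub>F \<theta> in at_right 0. dist (cis \<theta>) (cis 0) < \<delta> \<and> 0 < \<theta> \<and> \<theta> < 1"
      by eventually_elim auto
    then obtain \<theta> where "dist (cis \<theta>) (cis 0) < \<delta>" "0 < \<theta>" "\<theta> < 1"
      using eventually_happens[of _ "at_right (0 :: real)"] by (auto simp: trivial_limit_at_right_real)
    moreover from this have "sin \<theta> > 0"
      using pi_gt3 by (intro sin_gt_zero) auto
    ultimately show thesis
      by (intro that[of "cis \<theta>"]) (auto simp: dist_norm complex_eq_iff)
  qed
  define Z where "Z = restrict (\<lambda>v. z \<odot>\<^bsub>H\<^esub> v) (carrier H)"
  have Z: "Z \<in> carrier (unitary_group H)"
    unfolding Z_def
  proof (rule restrict_in_unitary_group[where T' = "\<lambda>v. cnj z \<odot>\<^bsub>H\<^esub> v"])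
    have zz: "z * cnj z = 1" "cnj z * z = 1"
      using z(1) by (simp_all add: mult.commute flip: complex_norm_square)
    then have cancel: "z * (cnj z * w) = w" "cnj z * (z * w) = w" for w
      by (simp_all only: mult.assoc[symmetric] mult_1)
    show "z \<odot>\<^bsub>H\<^esub> v \<in> carrier H \<and> cnj z \<odot>\<^bsub>H\<^esub> v \<in> carrier H \<and>
        z \<odot>\<^bsub>H\<^esub> (cnj z \<odot>\<^bsub>H\<^esub> v) = v \<and> cnj z \<odot>\<^bsub>H\<^esub> (z \<odot>\<^bsub>H\<^esub> v) = v" for v
      using carrier_H by (simp add: H_def cancel fun_eq_iff)
    show "cinner H (z \<odot>\<^bsub>H\<^esub> v) (z \<odot>\<^bsub>H\<^esub> w) = cinner H v w" for v w
      using zz carrier_H by (simp add: cinner_smult_left cinner_smult_right flip: mult.assoc)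
  qed (use carrier_H in \<open>auto simp: H_def algebra_simps\<close>)
  define \<rho> where "\<rho> x = (if x = new i then Z else \<one>\<^bsub>unitary_group H\<^esub>)" for x
  have \<rho>: "\<rho> \<in> generators \<rightarrow> carrier (unitary_group H)"
    using Z by (auto simp: \<rho>_def)
  have \<rho>_R: "word_value (unitary_group H) \<rho> r = \<one>\<^bsub>unitary_group H\<^esub>" if "r \<in> R" for r
  proof (rule U.word_value_one)
    fix x assume "x \<in> fst ` set r"
    then have "x \<in> X"
      using that relators by (auto simp: carrier_free_group subset_iff)
    then show "\<rho> x = \<one>\<^bsub>unitary_group H\<^esub>"
      using new_notin[OF i] by (auto simp: \<rho>_def)
  qed
  have "word_value (unitary_group H) \<rho> q = \<one>\<^bsub>unitary_group H\<^esub>" if q: "q \<in> relations - {killer i}" for q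
  proof (cases "q \<in> R")
    case True
    then show ?thesis
      by (rule \<rho>_R)
  next
    case False
    then obtain k where k: "k \<in> R \<times> UNIV" "q = killer k"
      using q by (auto simp: relations_def)
    then have "new k \<noteq> new i"
      using q i inj_onD[OF new_inj] by blast
    then show ?thesis
      using k hom_killer[OF U.group_axioms \<rho> k(1)] \<rho>_R[of "fst k"]
      by (auto simp: \<rho>_def U.killing_relator_one)
  qed
  moreover have "hnorm H (\<rho> x (\<lambda>_. 1) \<ominus>\<^bsub>H\<^esub> (\<lambda>_. 1)) \<le> \<delta> * hnorm H (\<lambda>_. 1)" for x
  proof (cases "x = new i")
    case True
    then have "hnorm H (\<rho> x (\<lambda>_. 1) \<ominus>\<^bsub>H\<^esub> (\<lambda>_. 1)) = cmod (z - 1) * hnorm H (\<lambda>_. 1)"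
      using diff_smult_self[OF carrier_H] carrier_H by (simp add: \<rho>_def Z_def hnorm_smult)
    then show ?thesis
      using z(3) carrier_H by (simp add: mult_right_mono)
  next
    case False
    then show ?thesis
      using \<open>\<delta> > 0\<close> carrier_H by (simp add: \<rho>_def one_unitary_group a_minus_def r_neg)
  qed
  moreover have "v = \<zero>\<^bsub>H\<^esub>" if "\<forall>x\<in>generators. \<rho> x v = v" for v
  proof -
    have "new i \<in> generators"
      using i by (simp add: generators_def)
    then have "Z v = v"
      using that by (auto simp: \<rho>_def)
    then have "z * v x = v x" for x
      using carrier_H[of v] by (simp add: Z_def) (simp add: H_def fun_eq_iff)
    then show ?thesis
      using z(2) by (auto simp: H_def)
  qed
  moreover have "(\<lambda>_. 1) \<noteq> \<zero>\<^bsub>H\<^esub>"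
    by (simp add: H_def fun_eq_iff)
  ultimately show "\<exists>(H :: (unit \<Rightarrow> complex) hilbert) \<rho> \<xi>. hilbert_space H \<and>
      \<rho> \<in> generators \<rightarrow> carrier (unitary_group H) \<and>
      (\<forall>r\<in>relations - {killer i}. word_value (unitary_group H) \<rho> r = \<one>\<^bsub>unitary_group H\<^esub>) \<and>
      \<xi> \<in> carrier H \<and> \<xi> \<noteq> \<zero>\<^bsub>H\<^esub> \<and>
      (\<forall>x\<in>generators. hnorm H (\<rho> x \<xi> \<ominus>\<^bsub>H\<^esub> \<xi>) \<le> \<delta> * hnorm H \<xi>) \<and>
      (\<forall>v\<in>carrier H. (\<forall>x\<in>generators. \<rho> x v = v) \<longrightarrow> v = \<zero>\<^bsub>H\<^esub>)"
    using hilbert_space_axioms \<rho> carrier_H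
    by (intro exI[of _ H] exI[of _ \<rho>] exI[of _ "\<lambda>_. 1"]) auto
qed

text \<open>
  The other relators \<open>r'\<close> hold in \<open>\<langle>X | R - {r}\<rangle>\<close>, so their new generators can be sent to \<open>1\<close>;  the
  two new generators of \<open>r\<close> go to the operators \<open>A\<close> and \<open>B\<close> of the deformation.
\<close>

lemma not_property_T_without_relator:
  assumes r: "r \<in> R" and irredundant: "r \<notin> normal_closure (free_group X) (R - {r})"
  shows "\<not> property_T (presented_group generators (relations - {r}))"
proof (rule not_property_T_presented_group)
  show "relations - {r} \<subseteq> carrier (free_group generators)"
    using relations_subset by blast
  let ?\<Gamma> = "presented_group X (R - {r})" and ?c = "presented_class X (R - {r})"
  have sub: "R - {r} \<subseteq> carrier (free_group X)"
    using relators by blast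
  interpret \<Gamma>: group ?\<Gamma>
    by (rule group_presented_group[OF sub])
  have c: "?c \<in> hom (free_group X) ?\<Gamma>"
    by (rule presented_class_hom[OF sub])
  have rX: "r \<in> carrier (free_group X)"
    using r relators by blast
  have cr: "?c r \<in> carrier ?\<Gamma>" "?c r \<noteq> \<one>\<^bsub>?\<Gamma>\<^esub>"
    using hom_in_carrier[OF c rX] presented_class_eq_one[OF sub rX] irredundant by auto
  fix \<delta> :: real assume "\<delta> > 0"
  obtain H :: "('x word set point \<Rightarrow> complex) hilbert" and \<sigma> A B \<xi> where H: "hilbert_space H"
    and \<sigma>: "\<sigma> \<in> hom ?\<Gamma> (unitary_group H)"
    and AB: "A \<in> carrier (unitary_group H)" "B \<in> carrier (unitary_group H)"
    and rel_A: "killing_relator (unitary_group H) (\<sigma> (?c r)) A = \<one>\<^bsub>unitary_group H\<^esub>"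
    and rel_B: "killing_relator (unitary_group H) (\<sigma> (?c r)) B = \<one>\<^bsub>unitary_group H\<^esub>"
    and \<xi>: "\<xi> \<in> carrier H" "\<xi> \<noteq> \<zero>\<^bsub>H\<^esub>"
    and fixed: "\<And>g. g \<in> carrier ?\<Gamma> \<Longrightarrow> \<sigma> g \<xi> = \<xi>" "B \<xi> = \<xi>"
    and small: "hnorm H (A \<xi> \<ominus>\<^bsub>H\<^esub> \<xi>) \<le> \<delta> * hnorm H \<xi>"
    and no_fixed: "\<And>v. \<lbrakk>v \<in> carrier H; \<And>g. g \<in> carrier ?\<Gamma> \<Longrightarrow> \<sigma> g v = v; A v = v; B v = v\<rbrakk>
      \<Longrightarrow> v = \<zero>\<^bsub>H\<^esub>"
    by (fact unitary_deformation[OF \<Gamma>.group_axioms cr \<open>\<delta> > 0\<close>])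
  interpret hilbert_space H
    by (rule H)
  interpret U: group "unitary_group H"
    by (rule group_unitary_group)
  define \<rho> where "\<rho> x = (if x \<in> X then \<sigma> (?c [(x, True)]) else if x = new (r, False) then A
    else if x = new (r, True) then B else \<one>\<^bsub>unitary_group H\<^esub>)" for x
  have c_gen: "?c [(x, True)] \<in> carrier ?\<Gamma>" if "x \<in> X" for x
    using hom_in_carrier[OF c] that by simp
  have \<rho>: "\<rho> \<in> generators \<rightarrow> carrier (unitary_group H)"
    using AB hom_in_carrier[OF \<sigma> c_gen] by (auto simp: \<rho>_def)
  have \<sigma>c: "\<sigma> \<circ> ?c \<in> hom (free_group X) (unitary_group H)"
    by (rule Group.hom_compose[OF c \<sigma>])
  have \<rho>_word: "word_value (unitary_group H) \<rho> w = \<sigma> (?c w)" if w: "w \<in> carrier (free_group X)" for w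
    using U.hom_free_group_eq[OF \<sigma>c w] w
      U.word_value_cong[of X \<rho> "\<lambda>x. (\<sigma> \<circ> ?c) [(x, True)]" w]
    by (simp add: \<rho>_def carrier_free_group)
  have new_notin_X: "new (r', t) \<notin> X" if "r' \<in> R" for r' t
    using new_notin that by simp
  have new_eq: "new (r', t) = new (r, t') \<longleftrightarrow> r' = r \<and> t = t'" if "r' \<in> R" for r' t t'
    using inj_on_eq_iff[OF new_inj, of "(r', t)" "(r, t')"] that r by simp
  have \<rho>_new: "\<rho> (new (r', t)) = (if r' = r then if t then B else A else \<one>\<^bsub>unitary_group H\<^esub>)"
    if "r' \<in> R" for r' t
    using that by (simp add: \<rho>_def new_notin_X new_eq)
  have "word_value (unitary_group H) \<rho> q = \<one>\<^bsub>unitary_group H\<^esub>" if q: "q \<in> relations - {r}" for q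
  proof (cases "q \<in> R")
    case True
    then have "?c q = \<one>\<^bsub>?\<Gamma>\<^esub>"
      using q by (intro presented_class_relator[OF sub]) auto
    then show ?thesis
      using True relators \<rho>_word hom_one[OF \<sigma> \<Gamma>.group_axioms U.group_axioms] by auto
  next
    case False
    then obtain r' t where k: "r' \<in> R" "q = killer (r', t)"
      using q by (auto simp: relations_def)
    have "word_value (unitary_group H) \<rho> r' = \<sigma> (?c r')" "\<sigma> (?c r') \<in> carrier (unitary_group H)"
      using k relators \<rho>_word hom_in_carrier[OF \<sigma>c] by auto
    then show ?thesis
      using k hom_killer[OF U.group_axioms \<rho>, of "(r', t)"] rel_A rel_B
      by (auto simp: \<rho>_new U.killing_relator_one)
  qed
  moreover have "hnorm H (\<rho> x \<xi> \<ominus>\<^bsub>H\<^esub> \<xi>) \<le> \<delta> * hnorm H \<xi>" for x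
  proof -
    have "\<rho> x = A \<or> \<rho> x \<xi> = \<xi>"
      using fixed c_gen \<xi> by (simp add: \<rho>_def one_unitary_group)
    moreover have "hnorm H (\<xi> \<ominus>\<^bsub>H\<^esub> \<xi>) \<le> \<delta> * hnorm H \<xi>"
      using \<open>\<delta> > 0\<close> \<xi> by (simp add: a_minus_def r_neg)
    ultimately show ?thesis
      using small by auto
  qed
  moreover have "v = \<zero>\<^bsub>H\<^esub>" if v: "v \<in> carrier H" and inv: "\<forall>x\<in>generators. \<rho> x v = v" for v
  proof (rule no_fixed[OF v])
    have "new (r, t) \<in> generators" for t
      using r by (simp add: generators_def)
    then show "A v = v" "B v = v"
      using inv \<rho>_new[OF r, of False] \<rho>_new[OF r, of True] by fastforce+
    fix g assume "g \<in> carrier ?\<Gamma>"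
    then obtain w where w: "w \<in> carrier (free_group X)" "g = ?c w"
      unfolding carrier_presented_group[OF sub] by blast
    have gv: "\<sigma> g v \<in> carrier H"
      using unitary_group_closed[OF hom_in_carrier[OF \<sigma> \<open>g \<in> carrier ?\<Gamma>\<close>] v] .
    have "hnorm H (\<rho> x v \<ominus>\<^bsub>H\<^esub> v) \<le> 0" if "x \<in> generators" for x
      using inv that v by (simp add: a_minus_def r_neg)
    moreover have "fst ` set w \<subseteq> generators"
      using w X_subset by (auto simp: carrier_free_group)
    ultimately have "hnorm H (\<sigma> g v \<ominus>\<^bsub>H\<^esub> v) \<le> real (length w) * 0"
      using hnorm_word_displacement[OF \<rho> v, of 0 w] w by (simp add: \<rho>_word)
    then have "\<sigma> g v \<ominus>\<^bsub>H\<^esub> v = \<zero>\<^bsub>H\<^esub>"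
      using gv v hnorm_eq_zero hnorm_nonneg by (metis antisym minus_closed mult_zero_right)
    then show "\<sigma> g v = v"
      using gv v diff_eq_zero by blast
  qed
  ultimately show "\<exists>(H :: ('x word set point \<Rightarrow> complex) hilbert) \<rho> \<xi>. hilbert_space H \<and>
      \<rho> \<in> generators \<rightarrow> carrier (unitary_group H) \<and>
      (\<forall>q\<in>relations - {r}. word_value (unitary_group H) \<rho> q = \<one>\<^bsub>unitary_group H\<^esub>) \<and>
      \<xi> \<in> carrier H \<and> \<xi> \<noteq> \<zero>\<^bsub>H\<^esub> \<and>
      (\<forall>x\<in>generators. hnorm H (\<rho> x \<xi> \<ominus>\<^bsub>H\<^esub> \<xi>) \<le> \<delta> * hnorm H \<xi>) \<and>
      (\<forall>v\<in>carrier H. (\<forall>x\<in>generators. \<rho> x v = v) \<longrightarrow> v = \<zero>\<^bsub>H\<^esub>)"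
    using H \<rho> \<xi> by (intro exI[of _ H] exI[of _ \<rho>] exI[of _ \<xi>]) auto
qed

end

lemma fresh_injection:
  fixes X :: "nat set"
  assumes "finite X" "finite I"
  obtains f :: "'i \<Rightarrow> nat" where "inj_on f I" "\<And>i. i \<in> I \<Longrightarrow> f i \<notin> X"
proof -
  have "infinite (- X)"
    using assms(1) by (simp add: finite_compl)
  then obtain B where B: "finite B" "card B = card I" "B \<subseteq> - X"
    using infinite_arbitrarily_large by blast
  then obtain f where "bij_betw f I B"
    using finite_same_card_bij[OF assms(2) B(1)] by auto
  then show thesis
    using B(3) by (intro that[of f]) (auto simp: bij_betw_def)
qed

theorem theorem3:
  fixes G :: "('a, 'b) monoid_scheme"
  assumes "group G"
    and "finitely_presented G"
    and "property_T G"
  shows "\<exists>(X :: nat set) R. finite X \<and> finite R \<and> is_presentation G X R \<and> just_T X R"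
proof -
  obtain X :: "nat set" and R\<^sub>0 where X: "finite X" and R\<^sub>0: "finite R\<^sub>0"
      "R\<^sub>0 \<subseteq> carrier (free_group X)" "presented_group X R\<^sub>0 \<cong> G"
    using assms(2) by (auto simp: finitely_presented_def is_presentation_def)
  obtain R where R: "R \<subseteq> R\<^sub>0" "presented_group X R = presented_group X R\<^sub>0"
    and irredundant: "\<And>r. r \<in> R \<Longrightarrow> r \<notin> normal_closure (free_group X) (R - {r})"
    using irredundant_relators[OF R\<^sub>0(1,2)] by blast
  have "finite R"
    using R(1) R\<^sub>0(1) by (rule finite_subset)
  then obtain new :: "nat word \<times> bool \<Rightarrow> nat"
    where new: "inj_on new (R \<times> UNIV)" "\<And>i. i \<in> R \<times> UNIV \<Longrightarrow> new i \<notin> X"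
    using fresh_injection[OF X finite_cartesian_product[OF _ finite[of "UNIV :: bool set"]]] by metis
  interpret killed_generators X R new
    using R R\<^sub>0 new by unfold_locales auto
  let ?P = "presented_group generators relations"
  have P: "group ?P"
    by (rule group_presented_group[OF relations_subset])
  have iso: "?P \<cong> G"
    using presented_group_iso R(2) R\<^sub>0(3) iso_trans by metis
  then have "property_T ?P"
    using property_T_iso[OF assms(1) P _ assms(3)] group.iso_sym[OF P] by blast
  moreover have "\<not> property_T (presented_group generators (relations - {q}))" if "q \<in> relations" for q
    using that not_property_T_without_killer not_property_T_without_relator irredundant
    by (auto simp: relations_def)
  ultimately have "just_T generators relations"
    by (simp add: just_T_def)
  moreover have "finite generators" "finite relations"
    using X \<open>finite R\<close> by (auto simp: generators_def relations_def)
  moreover have "is_presentation G generators relations"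
    using iso relations_subset by (simp add: is_presentation_def)
  ultimately show ?thesis
    by blast
qed

end
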